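(* Let $u,v,w,t,n$ be non-negative integers. Let $A(u,v,w,t,n)$ be the number of partitions of $n$ into $u$ distinct parts of color $a$, $v$ distinct parts of color $b$, $w$ distinct parts of color $c$ and $t$ distinct parts of color $d$ (i.e. the number of quadruples of partitions into distinct parts, the first with $u$ parts, the second with $v$, the third with $w$, the fourth with $t$, whose sizes sum to $n$). Let $B(u,v,w,t,n)$ be the number of finite sequences $(\lambda_1,\dots,\lambda_s)$ of colored parts $\lambda_i=(k_i)_{c_i}$, with $k_i$ a positive integer and $c_i\in\{ab,ac,ad,a,bc,bd,b,cd,c,d\}$, such that: (i) every part with a secondary color has size at least $2$; (ii) for every $i<s$, $k_i-k_{i+1}\ge \Delta(c_i,c_{i+1})$; (iii) no three consecutive parts $(\lambda_i,\lambda_{i+1},\lambda_{i+2})$ equal one of the forbidden patterns $((k+2)_{cd},(k+2)_{ab},k_c)$, $((k+2)_{cd},(k+2)_{ab},k_d)$, $((k+2)_{ad},(k+1)_{bc},k_a)$ for an integer $k\ge 1$, except that the pattern $(3_{ad},2_{bc},1_a)$ is allowed; (iv) $\sum_i k_i=n$, and there are exactly $u$ parts whose color is one of $a,ab,ac,ad$, exactly $v$ parts whose color is one of $b,ab,bc,bd$, exactly $w$ parts whose color is one of $c,ac,bc,cd$, and exactly $t$ parts whose color is one of $d,ad,bd,cd$. Then $A(u,v,w,t,n)=B(u,v,w,t,n)$ for all $u,v,w,t,n$, and \[\sum_{u,v,w,t,n\ge 0}B(u,v,w,t,n)a^ub^vc^wd^tq^n=(-aq;q)_\infty(-bq;q)_\infty(-cq;q)_\infty(-dq;q)_\infty,\]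 where $(x;q)_\infty=\prod_{k\ge0}(1-xq^k)$.
   Context: There are four primary colors $a,b,c,d$ and six secondary colors $ab,ac,ad,bc,bd,cd$ (a secondary color is regarded as the product of two primary colors). The ten colors are totally ordered by $ab<ac<ad<a<bc<bd<b<cd<c<d$. A part of size $k$ and color $p$ is written $k_p$. For colors $p,q$ define $\Delta(p,q)=1+\chi(p<q)$ if at least one of $p,q$ is primary; $\Delta(p,q)=1+\chi(p\le q)$ if both are secondary and $(p,q)\notin\{(cd,ab),(ad,bc)\}$; and $\Delta(cd,ab)=0$, $\Delta(ad,bc)=1$. Here $\chi(\text{statement})$ is $1$ if the statement is true and $0$ otherwise. *)

theory Defs
  imports "HOL-Analysis.Analysis" "HOL-Computational_Algebra.Formal_Power_Series"
begin

datatype primary = Pa | Pb | Pc | Pd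

datatype color = Ca | Cb | Cc | Cd | Cab | Cac | Cad | Cbc | Cbd | Ccd

fun primaries :: "color \<Rightarrow> primary set" where
  "primaries Ca = {Pa}"
| "primaries Cb = {Pb}"
| "primaries Cc = {Pc}"
| "primaries Cd = {Pd}"
| "primaries Cab = {Pa, Pb}"
| "primaries Cac = {Pa, Pc}"
| "primaries Cad = {Pa, Pd}"
| "primaries Cbc = {Pb, Pc}"
| "primaries Cbd = {Pb, Pd}"
| "primaries Ccd = {Pc, Pd}"

definition is_primary :: "color \<Rightarrow> bool" where
  "is_primary p \<longleftrightarrow> p \<in> {Ca, Cb, Cc, Cd}"

definition is_secondary :: "color \<Rightarrow> bool" where
  "is_secondary p \<longleftrightarrow> p \<in> {Cab, Cac, Cad, Cbc, Cbd, Ccd}"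

text \<open>The order is ab < ac < ad < a < bc < bd < b < cd < c < d.\<close>

fun color_rank :: "color \<Rightarrow> nat" where
  "color_rank Cab = 0"
| "color_rank Cac = 1"
| "color_rank Cad = 2"
| "color_rank Ca = 3"
| "color_rank Cbc = 4"
| "color_rank Cbd = 5"
| "color_rank Cb = 6"
| "color_rank Ccd = 7"
| "color_rank Cc = 8"
| "color_rank Cd = 9"

lemma color_rank_inject: "color_rank p = color_rank q \<Longrightarrow> p = q"
  by (cases p; cases q) simp_all

instantiation color :: linorder
begin

definition less_eq_color :: "color \<Rightarrow> color \<Rightarrow> bool" where
  "p \<le> q \<longleftrightarrow> color_rank p \<le> color_rank q"

definition less_color :: "color \<Rightarrow> color \<Rightarrow> bool" where
  "p < q \<longleftrightarrow> color_rank p < color_rank q"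

instance
  by standard (auto simp: less_eq_color_def less_color_def intro: color_rank_inject)

end

definition Delta :: "color \<Rightarrow> color \<Rightarrow> int" where
  "Delta p q =
     (if is_primary p \<or> is_primary q then 1 + of_bool (p < q)
      else if (p, q) = (Ccd, Cab) then 0
      else if (p, q) = (Cad, Cbc) then 1
      else 1 + of_bool (p \<le> q))"

text \<open>The pair \<open>(k, p)\<close> is the part of size \<open>k\<close> and color \<open>p\<close>.\<close>

type_synonym part = "nat \<times> color"

definition forbidden :: "part \<Rightarrow> part \<Rightarrow> part \<Rightarrow> bool" where
  "forbidden x y z \<longleftrightarrow>
     (\<exists>k\<ge>1. (x, y, z) \<in> {((k + 2, Ccd), (k + 2, Cab), (k, Cc)),
                      ((k + 2, Ccd), (k + 2, Cab), (k, Cd)),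
                      ((k + 2, Cad), (k + 1, Cbc), (k, Ca))})
     \<and> (x, y, z) \<noteq> ((3, Cad), (2, Cbc), (1, Ca))"

definition admissible :: "part list \<Rightarrow> bool" where
  "admissible xs \<longleftrightarrow>
     (\<forall>(k, p) \<in> set xs. k \<ge> 1) \<and>
     (\<forall>(k, p) \<in> set xs. is_secondary p \<longrightarrow> k \<ge> 2) \<and>
     (\<forall>i. i + 1 < length xs \<longrightarrow>
        int (fst (xs ! i)) - int (fst (xs ! (i + 1))) \<ge> Delta (snd (xs ! i)) (snd (xs ! (i + 1)))) \<and>
     (\<forall>i. i + 2 < length xs \<longrightarrow> \<not> forbidden (xs ! i) (xs ! (i + 1)) (xs ! (i + 2)))"

definition num_parts :: "primary \<Rightarrow> part list \<Rightarrow> nat" where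
  "num_parts x xs = length (filter (\<lambda>(k, p). x \<in> primaries p) xs)"

definition count_B :: "nat \<Rightarrow> nat \<Rightarrow> nat \<Rightarrow> nat \<Rightarrow> nat \<Rightarrow> nat" where
  "count_B u v w t n =
     card {xs. admissible xs \<and> sum_list (map fst xs) = n \<and>
               num_parts Pa xs = u \<and> num_parts Pb xs = v \<and>
               num_parts Pc xs = w \<and> num_parts Pd xs = t}"

text \<open>A partition into distinct parts is represented by the finite set of its parts.\<close>

definition distinct_partitions :: "nat \<Rightarrow> nat set set" where
  "distinct_partitions m = {S. finite S \<and> (\<forall>k\<in>S. k \<ge> 1) \<and> card S = m}"

definition count_A :: "nat \<Rightarrow> nat \<Rightarrow> nat \<Rightarrow> nat \<Rightarrow> nat \<Rightarrow> nat" where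
  "count_A u v w t n =
     card {(P, Q, R, S). P \<in> distinct_partitions u \<and> Q \<in> distinct_partitions v \<and>
                         R \<in> distinct_partitions w \<and> S \<in> distinct_partitions t \<and>
                         \<Sum>P + \<Sum>Q + \<Sum>R + \<Sum>S = n}"

text \<open>
  The infinite product is taken in the topology of the ring; for formal power series this is
  the metric topology of the library, i.e. coefficientwise stabilisation.
\<close>

definition qpochhammer_inf :: "'r \<Rightarrow> 'r \<Rightarrow> 'r :: {t2_space, comm_ring_1}" where
  "qpochhammer_inf x q = (\<Prod>k. 1 - x * q ^ k)"

end

theory Submission
  imports Defs
begin

text \<open>
  Read a quadruple of partitions into distinct parts as one strictly decreasing word \<open>R\<close> of primary
  parts. Its letters are moved one after the other to the end of an admissible word \<open>L\<close>. If the next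
  letter \<open>r\<close> is too close to the last letter \<open>p\<close> of \<open>L\<close>, then \<open>p\<close> is primary as well, and the two are
  merged into the secondary part \<open>x = p + r\<close>. As long as \<open>x\<close> does not fit at the end of \<open>L\<close>, the last
  letter \<open>p\<close> of \<open>L\<close> is primary and crosses \<open>x\<close>: \<open>x\<close> becomes \<open>x + 1\<close>, and \<open>p - 1\<close> returns to the front
  of \<open>R\<close>. Each of these moves can be undone by looking at the current state only: the part \<open>x\<close> was
  just created iff its lower half exceeds the first letter of \<open>R\<close>.

  Hence the moves form a weight-preserving bijection from the non-final to the non-initial states.
  As there are finitely many states of a given weight, there are as many initial states (quadruples of
  partitions) as final states (admissible words); no termination argument is needed.
\<close>

section \<open>Arithmetic of the difference conditions\<close>

lemma is_secondary_iff: "is_secondary p \<longleftrightarrow> \<not> is_primary p"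
  by (cases p) (simp_all add: is_primary_def is_secondary_def)

definition gap_ok :: "part \<Rightarrow> part \<Rightarrow> bool" where
  "gap_ok x y \<longleftrightarrow> int (fst x) - int (fst y) \<ge> Delta (snd x) (snd y)"

abbreviation prim :: "part \<Rightarrow> bool" where "prim x \<equiv> is_primary (snd x)"

fun primary_index :: "color \<Rightarrow> nat" where
  "primary_index Ca = 0"
| "primary_index Cb = 1"
| "primary_index Cc = 2"
| "primary_index Cd = 3"
| "primary_index _ = 0"

text \<open>
  The strict order on primary parts is that of \<open>pos\<close>, and every secondary part is in a unique way the
  sum of its two halves, primary parts of different colors at distance less than 4 in this order.
\<close>
definition pos :: "part \<Rightarrow> nat" where "pos x = 4 * fst x + primary_index (snd x)"

fun small_color :: "color \<Rightarrow> color" where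
  "small_color Cab = Ca" | "small_color Cac = Ca" | "small_color Cad = Ca"
| "small_color Cbc = Cb" | "small_color Cbd = Cb" | "small_color Ccd = Cc" | "small_color c = c"

fun large_color :: "color \<Rightarrow> color" where
  "large_color Cab = Cb" | "large_color Cac = Cc" | "large_color Cad = Cd"
| "large_color Cbc = Cc" | "large_color Cbd = Cd" | "large_color Ccd = Cd" | "large_color c = c"

definition lower_half :: "part \<Rightarrow> part" where
  "lower_half x = (fst x div 2, (if even (fst x) then small_color else large_color) (snd x))"
definition upper_half :: "part \<Rightarrow> part" where
  "upper_half x = ((fst x + 1) div 2, (if even (fst x) then large_color else small_color) (snd x))"
definition up :: "part \<Rightarrow> part" where "up x = (fst x + 1, snd x)"
definition down :: "part \<Rightarrow> part" where "down x = (fst x - 1, snd x)"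

lemma fst_up [simp]: "fst (up x) = fst x + 1" and snd_up [simp]: "snd (up x) = snd x"
  and fst_down [simp]: "fst (down x) = fst x - 1" and snd_down [simp]: "snd (down x) = snd x"
  by (simp_all add: up_def down_def)

lemma pos_up [simp]: "pos (up x) = pos x + 4" by (simp add: pos_def)
lemma pos_down: "fst x \<ge> 1 \<Longrightarrow> pos (down x) = pos x - 4" by (simp add: pos_def)
lemma up_down [simp]: "fst x \<ge> 1 \<Longrightarrow> up (down x) = x" by (simp add: up_def down_def)
lemma down_up [simp]: "down (up x) = x" by (simp add: up_def down_def)

text \<open>\<open>Delta\<close> with values in \<open>nat\<close>: no value is negative, so the
  difference condition becomes an additive inequality without truncated subtraction.\<close>

definition gap :: "color \<Rightarrow> color \<Rightarrow> nat" where
  "gap p q = (if is_primary p \<or> is_primary q then 1 + of_bool (p < q)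
      else if (p, q) = (Ccd, Cab) then 0
      else if (p, q) = (Cad, Cbc) then 1
      else 1 + of_bool (p \<le> q))"

lemma Delta_eq_gap: "Delta p q = int (gap p q)"
  unfolding Delta_def gap_def by (simp only: if_distrib [of int] of_nat_add of_nat_of_bool of_nat_1
    of_nat_0)

lemma gap_ok_iff: "gap_ok x y \<longleftrightarrow> fst y + gap (snd x) (snd y) \<le> fst x"
  unfolding gap_ok_def Delta_eq_gap by linarith

lemmas part_defs = gap_ok_iff gap_def is_primary_def less_color_def less_eq_color_def pos_def
  lower_half_def upper_half_def

text \<open>Among primary colors the order is that of \<open>primary_index\<close>, and a unit of
  size counts 4 in \<open>pos\<close>. So the two-valued gap turns into the single distance
  4.\<close>

lemma gap_ok_prim: "prim p \<Longrightarrow> prim q \<Longrightarrow> gap_ok p q \<longleftrightarrow> pos q + 4 \<le> pos p"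
  by (cases "snd p"; cases "snd q") (auto simp: part_defs)

lemma prim_lower_half [simp]: "prim (lower_half x)"
  by (cases "snd x") (simp_all add: lower_half_def is_primary_def)

lemma prim_upper_half [simp]: "prim (upper_half x)"
  by (cases "snd x") (simp_all add: upper_half_def is_primary_def)

lemma even_odd_cases: obtains (even) k where "n = 2 * k" | (odd) k where "n = 2 * k + (1::nat)"
  by (metis evenE oddE)

lemma upper_half_gt_lower_half: "\<not> prim x \<Longrightarrow> pos (lower_half x) < pos (upper_half x)"
  by (cases "snd x"; cases "fst x" rule: even_odd_cases;
    simp add: is_primary_def pos_def lower_half_def upper_half_def)

lemma upper_half_lt_lower_half: "\<not> prim x \<Longrightarrow> pos (upper_half x) < pos (lower_half x) + 4"
  by (cases "snd x"; cases "fst x" rule: even_odd_cases;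
    simp add: is_primary_def pos_def lower_half_def upper_half_def)

lemma lower_half_up: "lower_half (up x) = upper_half x" by (auto simp: lower_half_def upper_half_def)
lemma upper_half_down: "fst x \<ge> 1 \<Longrightarrow> upper_half (down x) = lower_half x" by (metis lower_half_up up_down)

text \<open>For a primary and a secondary color the gaps in the two orders add up to 3, as exactly
  one strict comparison holds. This makes a crossing reversible.\<close>

lemma gap_ok_cross: "\<not> prim x \<Longrightarrow> prim r \<Longrightarrow> fst x \<ge> 1 \<Longrightarrow> gap_ok (up r) (down x) \<longleftrightarrow> \<not> gap_ok x r"
  by (cases "snd x"; cases "snd r") (auto simp: part_defs)

text \<open>Needed when \<open>x\<close> stops right after its creation: the next letter is then
  below its lower half.\<close>

lemma gap_ok_lower_half: "\<not> prim x \<Longrightarrow> prim r \<Longrightarrow> fst x \<ge> 2 \<Longrightarrow> fst r \<ge> 1 \<Longrightarrow> pos r < pos (lower_half x) \<Longrightarrow>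
  gap_ok x r"
  by (cases "snd x"; cases "snd r"; cases "fst x" rule: even_odd_cases; simp add: part_defs;
    (linarith | presburger))

text \<open>At size 2 the lower half is the small color with size 1. A part of size 1 fits after
  \<open>x\<close> only if its color precedes that of \<open>x\<close>, and then it lies below this
  half. Hence \<open>down x\<close> still has size at least 2 after an uncrossing.\<close>

lemma uncross_size: "\<not> prim x \<Longrightarrow> prim r \<Longrightarrow> fst x \<ge> 2 \<Longrightarrow> fst r \<ge> 1 \<Longrightarrow> \<not> pos r < pos (lower_half x) \<Longrightarrow>
  gap_ok x r \<Longrightarrow> fst x \<ge> 3"
  by (rule ccontr, subgoal_tac "fst x = 2", cases "snd x"; cases "snd r"; auto simp: part_defs)

text \<open>Reads the gap of two secondary parts on their halves. For \<open>z = up w\<close> the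
  first alternative says that uncrossing \<open>z\<close> stops before \<open>upper_half x\<close>,
  the second that it would stop just after crossing it. The next two lemmas give the
  converse.\<close>

lemma secondary_halves: "\<not> prim w \<Longrightarrow> \<not> prim x \<Longrightarrow> gap_ok (up w) x \<Longrightarrow> fst x \<ge> 2 \<Longrightarrow>
  pos (upper_half x) < pos (upper_half w) \<or> pos (lower_half x) < pos (lower_half w)"
  by (cases "snd x"; cases "snd w"; cases "fst x" rule: even_odd_cases;
    cases "fst w" rule: even_odd_cases; simp add: part_defs; (linarith | presburger))

lemma gap_ok_from_upper_halves: "\<not> prim w \<Longrightarrow> \<not> prim x \<Longrightarrow> pos (upper_half x) < pos (upper_half w) \<Longrightarrow>
  gap_ok (up w) x"
  by (cases "snd x"; cases "snd w"; cases "fst x" rule: even_odd_cases;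
    cases "fst w" rule: even_odd_cases;
     simp add: part_defs; (linarith | presburger))

lemma gap_ok_from_lower_halves: "\<not> prim w \<Longrightarrow> \<not> prim x \<Longrightarrow> 
  pos (lower_half x) < pos (lower_half w) \<Longrightarrow> gap_ok (up (upper_half x)) (upper_half w) \<Longrightarrow> gap_ok (up w) x"
  by (cases "snd x"; cases "snd w"; cases "fst x" rule: even_odd_cases;
    cases "fst w" rule: even_odd_cases; simp add: part_defs; (linarith | presburger))

lemma gap_ok_from_distant_halves: "\<not> prim z \<Longrightarrow> \<not> prim x \<Longrightarrow>
  pos (lower_half x) + 4 < pos (lower_half z) \<Longrightarrow> gap_ok z x"
  by (cases "snd x"; cases "snd z"; cases "fst x" rule: even_odd_cases;
    cases "fst z" rule: even_odd_cases; simp add: part_defs; (linarith | presburger))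

section \<open>Triangle inequality for gaps, and the forbidden patterns as its failures\<close>

lemmas gap_defs = gap_ok_iff gap_def is_primary_def less_color_def less_eq_color_def

text \<open>Outside the two exceptional pairs a gap is 1 plus the indicator of \<open>p < q\<close>,
  or of \<open>p = q\<close> for secondary colors; in a linear order this indicator is subadditive
  along \<open>p\<close>, \<open>q\<close>, \<open>c\<close>. If \<open>(p, c)\<close> itself is
  exceptional, the left side only gets smaller.\<close>

lemma gap_triangle:
  assumes "(p, q) \<notin> {(Ccd, Cab), (Cad, Cbc)}" "(q, c) \<notin> {(Ccd, Cab), (Cad, Cbc)}"
  shows "gap p c + 1 \<le> gap p q + gap q c"
proof -
  have "(1 + of_bool (p < c \<or> p = c \<and> \<not> is_primary p)) \<le>
      (of_bool (p < q \<or> p = q \<and> \<not> is_primary p) + (1 + of_bool (q < c \<or> q = c \<and>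
        \<not> is_primary q)) :: nat)"
    by (cases p q rule: linorder_cases; cases q c rule: linorder_cases) auto
  moreover have "gap p c \<le> 1 + of_bool (p < c \<or> p = c \<and> \<not> is_primary p)"
    by (auto simp: gap_def order.order_iff_strict)
  moreover have "gap p q = 1 + of_bool (p < q \<or> p = q \<and> \<not> is_primary p)"
    "gap q c = 1 + of_bool (q < c \<or> q = c \<and> \<not> is_primary q)"
    using assms by (auto simp: gap_def order.order_iff_strict)
  ultimately show ?thesis by linarith
qed

lemma gap_ok_triangle:
  assumes "gap_ok x y" "gap_ok y z" "(snd x, snd y) \<notin> {(Ccd, Cab), (Cad, Cbc)}"
    "(snd y, snd z) \<notin> {(Ccd, Cab), (Cad, Cbc)}"
  shows "fst z + 1 + gap (snd x) (snd z) \<le> fst x"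
  using gap_triangle[OF assms(3,4)] assms(1,2) unfolding gap_ok_iff by linarith

lemma not_anomalous: "prim x \<or> prim y \<Longrightarrow> (snd x, snd y) \<notin> {(Ccd, Cab), (Cad, Cbc)}"
  by (auto simp: is_primary_def)

text \<open>The bound \<open>fst y \<ge> 2\<close> in the second case absorbs the allowed triple of
  sizes 3, 2, 1.\<close>

lemma forbidden_iff: "forbidden w z y \<longleftrightarrow>
    snd w = Ccd \<and> snd z = Cab \<and> (snd y = Cc \<or> snd y = Cd) \<and> fst w = fst y + 2 \<and> fst z = fst y + 2 \<and>
      fst y \<ge> 1 \<or>
    snd w = Cad \<and> snd z = Cbc \<and> snd y = Ca \<and> fst w = fst y + 2 \<and> fst z = fst y + 1 \<and> fst y \<ge> 2"
  unfolding forbidden_def by (cases w; cases z; cases y) auto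

lemma forbidden_prims: "forbidden w z y \<Longrightarrow> \<not> prim w \<and> \<not> prim z \<and> prim y"
  unfolding forbidden_iff by (elim disjE conjE; simp add: is_primary_def)

text \<open>The reason for the allowed triple: there the last part, 1 of color a, lies below 1 of
  color b, the lower half of the middle part. In a forbidden triple the move back at
  \<open>x\<close> is an uncrossing, not an unmerging.\<close>

lemma forbidden_lower_half: "forbidden z x r \<Longrightarrow> \<not> pos r < pos (lower_half x)"
  unfolding forbidden_iff
  by (elim disjE conjE; cases "fst r" rule: even_odd_cases; simp add: pos_def lower_half_def;
    presburger?)

text \<open>Uncrossing \<open>x\<close> past \<open>r\<close> would place \<open>up r\<close> too
  close to \<open>z\<close>. \<open>gap_ok_up_sec\<close> is the converse: the forbidden patterns
  are the obstructions to this step.\<close>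

lemma forbidden_up: "forbidden z x r \<Longrightarrow> \<not> gap_ok z (up r)"
  unfolding forbidden_iff by (elim disjE conjE; simp add: gap_defs)

text \<open>This lemma and the next treat the two possible heads of \<open>uncross x R\<close>:
  neither completes a forbidden pattern if \<open>x\<close> keeps its gap to
  \<open>z\<close>.\<close>

lemma forbidden_upper_half: "forbidden w z (upper_half x) \<Longrightarrow> \<not> prim x \<Longrightarrow> fst x \<ge> 2 \<Longrightarrow> \<not> gap_ok z x"
  unfolding forbidden_iff
  by (elim disjE conjE; cases "snd x"; cases "fst x" rule: even_odd_cases;
    simp add: gap_defs upper_half_def; linarith?)

lemma forbidden_up': "forbidden w z (up r) \<Longrightarrow> \<not> prim x \<Longrightarrow> gap_ok x r \<Longrightarrow> \<not> gap_ok z x"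
  unfolding forbidden_iff
  by (elim disjE conjE; cases "snd x"; simp add: gap_defs; linarith?)

lemma gap_ok_upper_half_prim: "prim p \<Longrightarrow> \<not> prim x \<Longrightarrow> fst x \<ge> 2 \<Longrightarrow> gap_ok p x \<Longrightarrow> gap_ok p (upper_half x)"
  by (cases "snd p"; cases "snd x"; cases "fst x" rule: even_odd_cases;
    simp add: gap_defs upper_half_def)

lemma gap_ok_upper_half_sec: "\<not> prim z \<Longrightarrow> \<not> prim x \<Longrightarrow> fst x \<ge> 2 \<Longrightarrow> gap_ok z x \<Longrightarrow> gap_ok z (upper_half x)"
  by (cases "snd z"; cases "snd x"; cases "fst x" rule: even_odd_cases;
    simp add: gap_defs upper_half_def)

lemma gap_ok_up_prim: "prim p \<Longrightarrow> prim r \<Longrightarrow> gap_ok p x \<Longrightarrow> gap_ok x r \<Longrightarrow> gap_ok p (up r)"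
  using gap_ok_triangle[of p x r] not_anomalous[of p x] not_anomalous[of x r] by (simp add: gap_ok_iff)

text \<open>The triangle inequality through \<open>x\<close> suffices unless \<open>z\<close>,
  \<open>x\<close> have an exceptional pair of colors. Then one tight configuration remains: it is a
  forbidden pattern, or the allowed triple, which \<open>ns\<close> excludes.\<close>

lemma gap_ok_up_sec:
  assumes z: "\<not> prim z" and x: "\<not> prim x" and r: "prim r" "fst r \<ge> 1"
    and ns: "\<not> pos r < pos (lower_half x)" and zx: "gap_ok z x" and xr: "gap_ok x r"
      and nf: "\<not> forbidden z x r"
  shows "gap_ok z (up r)"
proof -
  consider "snd z = Ccd" "snd x = Cab" | "snd z = Cad" "snd x = Cbc"
    | "snd z \<noteq> Ccd \<or> snd x \<noteq> Cab" "snd z \<noteq> Cad \<or> snd x \<noteq> Cbc" by blast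
  then show ?thesis
  proof cases
    case 1
    with zx xr have le: "fst x \<le> fst z" "fst r + 2 \<le> fst x" using r(1)
      by (cases "snd r"; simp add: gap_defs)+
    show ?thesis
    proof (cases "snd r = Cc \<or> snd r = Cd")
      case True
      with 1 nf r(2) have "fst z \<noteq> fst r + 2 \<or> fst x \<noteq> fst r + 2" by (simp add: forbidden_iff)
      with le have "fst r + 3 \<le> fst z" by linarith
      with True 1 show ?thesis by (auto simp: gap_defs)
    next
      case False
      with le 1 r(1) show ?thesis by (cases "snd r"; simp add: gap_defs)
    qed
  next
    case 2
    with zx xr have le: "fst x + 1 \<le> fst z" "fst r + 1 + of_bool (snd r \<noteq> Ca) \<le> fst x" using r(1)
      by (cases "snd r"; simp add: gap_defs)+
    show ?thesis
    proof (cases "snd r = Ca")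
      case True
      have "fst x \<noteq> 2 \<or> fst r \<noteq> 1"
        using ns 2 True by (auto simp: pos_def lower_half_def)
      moreover have "fst r = 1 \<or> fst r \<ge> 2" using r(2) by linarith
      ultimately have "fst z \<noteq> fst r + 2 \<or> fst x \<noteq> fst r + 1"
        using nf 2 True by (auto simp: forbidden_iff)
      with le True have "fst r + 3 \<le> fst z" by simp
      with True 2 show ?thesis by (simp add: gap_defs)
    next
      case False
      with le 2 r(1) show ?thesis by (cases "snd r"; simp add: gap_defs)
    qed
  next
    case 3
    then show ?thesis
      using gap_ok_triangle[OF zx xr] not_anomalous[of x r] r(1) by (auto simp: gap_ok_iff)
  qed
qed

lemma gap_ok_down: "prim q \<Longrightarrow> gap_ok z q \<Longrightarrow> gap_ok q x \<Longrightarrow> gap_ok (down z) x"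
  using gap_ok_triangle[of z q x] not_anomalous[of z q] not_anomalous[of q x] by (simp add: gap_ok_iff)

lemma gap_ok_down_down: "fst z \<ge> 1 \<Longrightarrow> fst x \<ge> 1 \<Longrightarrow> gap_ok (down z) (down x) \<longleftrightarrow> gap_ok z x"
  by (auto simp: gap_ok_def)

lemma gap_ok_up_up: "gap_ok (up z) (up x) \<longleftrightarrow> gap_ok z x"
  by (auto simp: gap_ok_def)

text \<open>With a primary \<open>q\<close> in between, both gaps are ordinary and keep
  \<open>z\<close> and \<open>x\<close> too far apart for the pattern.\<close>

lemma forbidden_down: "forbidden (down z) x r \<Longrightarrow> prim q \<Longrightarrow> gap_ok z q \<Longrightarrow> \<not> gap_ok q x"
  unfolding forbidden_iff by (elim disjE conjE; cases "snd q"; simp add: gap_defs; linarith?)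

lemma forbidden_down_down: "forbidden (down z) (down x) s \<Longrightarrow> prim r \<Longrightarrow> gap_ok z (up r) \<Longrightarrow> gap_ok x r \<Longrightarrow>
  \<not> gap_ok r s"
  unfolding forbidden_iff by (elim disjE conjE; cases "snd r"; simp add: gap_defs; linarith?)

section \<open>Words and the uncrossing of a secondary part\<close>

definition sized :: "part \<Rightarrow> bool" where
  "sized y \<longleftrightarrow> fst y \<ge> 1 \<and> (prim y \<or> fst y \<ge> 2)"

text \<open>Admissible words are stored reversed: the head of the list is the last, smallest part.\<close>
fun fits :: "part list \<Rightarrow> part \<Rightarrow> bool" where
  "fits [] y = sized y"
| "fits [x] y = (sized y \<and> gap_ok x y)"
| "fits (x # w # L) y = (sized y \<and> gap_ok x y \<and> \<not> forbidden w x y)"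

primrec rev_admissible :: "part list \<Rightarrow> bool" where
  "rev_admissible [] = True"
| "rev_admissible (y # L) = (fits L y \<and> rev_admissible L)"

primrec descending :: "part list \<Rightarrow> bool" where
  "descending [] = True"
| "descending (r # R) = (prim r \<and> fst r \<ge> 1 \<and> (R = [] \<or> pos (hd R) < pos r) \<and> descending R)"

text \<open>
  \<open>uncross x R\<close> undoes all crossings of the moving part \<open>x\<close> and then the merge that created it;
  \<open>uncrossable x R\<close> says that these were indeed legal moves.
\<close>
fun uncross :: "part \<Rightarrow> part list \<Rightarrow> part list" where
  "uncross x [] = [upper_half x, lower_half x]"
| "uncross x (r # R) = (if pos r < pos (lower_half x) then upper_half x # lower_half x # r # R
  else up r # uncross (down x) R)"

fun uncrossable :: "part \<Rightarrow> part list \<Rightarrow> bool" where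
  "uncrossable x [] = True"
| "uncrossable x (r # R) = (pos r < pos (lower_half x) \<or> (gap_ok x r \<and> uncrossable (down x) R \<and>
  gap_ok (up r) (hd (uncross (down x) R))))"

text \<open>
  The only condition linking \<open>L\<close> and \<open>R\<close> concerns the last secondary part of \<open>L\<close>: it must be
  uncrossable with respect to the primary parts of \<open>L\<close> after it, followed by \<open>R\<close>.
\<close>
primrec coherent :: "part list \<Rightarrow> part list \<Rightarrow> bool" where
  "coherent [] R = descending R"
| "coherent (x # L) R = (if prim x then coherent L (x # R) else descending R \<and> uncrossable x R \<and>
  (R = [] \<or> fits (x # L) (hd R)))"

lemma uncross_neq_Nil [simp]: "uncross x R \<noteq> []"
  by (cases R) auto

lemma uncross_stop: "R = [] \<or> pos (hd R) < pos (lower_half x) \<Longrightarrow> uncross x R =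
  upper_half x # lower_half x # R"
  by (cases R) auto

lemma uncrossable_stop: "R = [] \<or> pos (hd R) < pos (lower_half x) \<Longrightarrow> uncrossable x R"
  by (cases R) auto

lemma sized_prim: "prim p \<Longrightarrow> sized p \<longleftrightarrow> fst p \<ge> 1"
  by (auto simp: sized_def)

lemma sized_sec: "\<not> prim x \<Longrightarrow> sized x \<longleftrightarrow> fst x \<ge> 2"
  by (auto simp: sized_def)

lemma fits_sized: "fits L y \<Longrightarrow> sized y"
  by (cases "(L, y)" rule: fits.cases) auto

lemma fits_gap_ok: "fits (x # L) y \<Longrightarrow> gap_ok x y"
  by (cases "(x # L, y)" rule: fits.cases) auto

lemma fits_prim_last: "prim p \<Longrightarrow> fits (p # L) y \<longleftrightarrow> sized y \<and> gap_ok p y"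
  by (cases L) (auto dest: forbidden_prims)

lemma fits_sec: "\<not> prim y \<Longrightarrow> fits (x # L) y \<longleftrightarrow> sized y \<and> gap_ok x y"
  by (cases L) (auto dest: forbidden_prims)

lemma fst_ge_of_pos: "4 * n \<le> pos p \<Longrightarrow> n \<le> fst p"
  by (cases "snd p"; simp add: pos_def)

lemma pos_ge: "4 * fst p \<le> pos p"
  by (simp add: pos_def)

lemma fst_lower_half_ge: "fst x \<ge> 2 \<Longrightarrow> 1 \<le> fst (lower_half x)" and fst_upper_half_ge: "fst x \<ge> 2 \<Longrightarrow>
  1 \<le> fst (upper_half x)"
  unfolding lower_half_def upper_half_def fst_conv by presburger+

lemma gap_ok_fst_prim: "gap_ok z q \<Longrightarrow> prim z \<or> prim q \<Longrightarrow> fst q < fst z"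
  by (auto simp: gap_ok_iff gap_def)

section \<open>Uncrossed words and pairs of secondary parts\<close>

lemma hd_uncross_prim: "descending R \<Longrightarrow> prim (hd (uncross x R))"
  by (cases R) (auto simp: is_primary_def[symmetric])

text \<open>Undoing the merge inserts the two halves in order above \<open>R\<close>. At a crossing,
  the last clause of \<open>uncrossable\<close> is a gap between primary parts, that is, distance
  4.\<close>

lemma descending_uncross: "\<not> prim x \<Longrightarrow> fst x \<ge> 2 \<Longrightarrow> uncrossable x R \<Longrightarrow> descending R \<Longrightarrow>
  descending (uncross x R)"
proof (induction R arbitrary: x)
  case Nil
  then show ?case using fst_lower_half_ge fst_upper_half_ge upper_half_gt_lower_half by simp
next
  case (Cons r R)
  show ?case
  proof (cases "pos r < pos (lower_half x)")
    case True
    then show ?thesis using Cons.prems using fst_lower_half_ge fst_upper_half_ge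
      upper_half_gt_lower_half by simp
  next
    case False
    with Cons.prems have x: "fst x \<ge> 3" by (auto intro: uncross_size)
    have "descending (uncross (down x) R)" using Cons.prems False x by (intro Cons.IH) auto
    moreover have "pos (hd (uncross (down x) R)) + 4 \<le> pos (up r)"
      using Cons.prems False hd_uncross_prim[of R "down x"] by (subst gap_ok_prim[symmetric]) auto
    ultimately show ?thesis using Cons.prems False by simp
  qed
qed

text \<open>Here the last clause of \<open>uncrossable\<close> comes for free. If the uncrossing of
  \<open>down z\<close> stops, its head is the lower half of \<open>z\<close>, at most
  \<open>q\<close> and so at least 4 below \<open>up q\<close>; otherwise its head is
  \<open>up (hd T)\<close>, and both letters have grown by one.\<close>

lemma gap_ok_up_uncross:
  assumes "\<not> pos q < pos (lower_half z)" "T = [] \<or> gap_ok q (hd T)" "fst z \<ge> 1" "prim q" "descending T"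
  shows "gap_ok (up q) (hd (uncross (down z) T))"
proof (cases "T = [] \<or> pos (hd T) < pos (lower_half (down z))")
  case True
  then show ?thesis using assms by (simp add: uncross_stop upper_half_down gap_ok_prim)
next
  case False
  then obtain t T' where "T = t # T'" by (cases T) auto
  then show ?thesis using assms False by (simp add: gap_ok_up_up)
qed

lemma uncrossable_pair_gap_ok:
  assumes A: "\<not> prim z" "\<not> prim x" "fst x \<ge> 2" "fst z \<ge> 1"
    "uncrossable z (upper_half x # lower_half x # R)"
  shows "gap_ok z x"
proof -
  have uz: "up (down z) = z" using A by simp
  \<comment> \<open>Stop at once, stop after the upper half, or cross both halves. The last is
    impossible, as the halves are less than 4 apart.\<close>
  consider (1) "pos (upper_half x) < pos (lower_half z)"
    | (2) "pos (lower_half x) < pos (lower_half (down z))"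
      "gap_ok (up (upper_half x)) (upper_half (down z))"
    | (3) "gap_ok (up (upper_half x)) (up (lower_half x))"
    using A by (auto split: if_splits)
  then show ?thesis
  proof cases
    case 1
    then show ?thesis using A gap_ok_from_upper_halves[of "down z" x] uz by (simp add: upper_half_down)
  next
    case 2
    then show ?thesis using A gap_ok_from_lower_halves[of "down z" x] uz by simp
  next
    case 3
    then show ?thesis using upper_half_lt_lower_half[of x] A by (simp add: gap_ok_prim)
  qed
qed

text \<open>Shows that a moving part that does not fit has a primary letter before it. Both
  secondary parts are uncrossed past the same letters in parallel until one of them stops.\<close>

lemma uncrossable_uncross_gap_ok:
  "\<not> prim z \<Longrightarrow> \<not> prim x \<Longrightarrow> fst x \<ge> 2 \<Longrightarrow> fst z \<ge> 1 \<Longrightarrow> uncrossable x R \<Longrightarrow> descending R \<Longrightarrow>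
    uncrossable z (uncross x R) \<Longrightarrow> gap_ok z x"
proof (induction R arbitrary: z x)
  case Nil
  then show ?case using uncrossable_pair_gap_ok[of z x "[]"] by simp
next
  case (Cons r R)
  show ?case
  proof (cases "pos r < pos (lower_half x)")
    case True
    then show ?thesis using Cons.prems by (intro uncrossable_pair_gap_ok[of z x "r # R"]) auto
  next
    case False
    with Cons.prems have x: "fst x \<ge> 3" by (auto intro: uncross_size)
    show ?thesis
    proof (cases "pos (up r) < pos (lower_half z)")
      case True
      then show ?thesis using Cons.prems False by (intro gap_ok_from_distant_halves) auto
    next
      case F2: False
      then have "gap_ok z (up r)" "uncrossable (down z) (uncross (down x) R)" using Cons.prems False
        by auto
      then have z: "fst z \<ge> 2" using gap_ok_fst_prim[of z "up r"] Cons.prems by auto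
      have "gap_ok (down z) (down x)"
        using Cons.prems F2 False x z by (intro Cons.IH) auto
      then show ?thesis using x z by (simp add: gap_ok_down_down)
    qed
  qed
qed

lemma uncrossable_pair:
  assumes A: "\<not> prim z" "\<not> prim x" "fst x \<ge> 2" "fst z \<ge> 1" "gap_ok z x"
  shows "uncrossable z (upper_half x # lower_half x # R)"
proof -
  have uz: "up (down z) = z" using A by simp
  have "pos (upper_half x) < pos (lower_half z) \<or> pos (lower_half x) < pos (lower_half (down z))"
    using secondary_halves[of "down z" x] A uz by (simp add: upper_half_down)
  moreover have "gap_ok z (upper_half x)" using A gap_ok_upper_half_sec by blast
  moreover have "gap_ok (up (upper_half x)) (upper_half (down z))"
    if "\<not> pos (upper_half x) < pos (lower_half z)"
    using that A by (simp add: upper_half_down gap_ok_prim)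
  ultimately show ?thesis by auto
qed

text \<open>The converse of \<open>uncrossable_uncross_gap_ok\<close>, for which the forbidden
  patterns must be excluded. The induction lowers \<open>z\<close> and \<open>x\<close>
  together.\<close>

lemma uncrossable_uncross:
  "\<not> prim z \<Longrightarrow> \<not> prim x \<Longrightarrow> fst x \<ge> 2 \<Longrightarrow> fst z \<ge> 1 \<Longrightarrow> uncrossable x R \<Longrightarrow> descending R \<Longrightarrow> gap_ok z x \<Longrightarrow>
   R = [] \<or> \<not> forbidden z x (hd R) \<Longrightarrow> uncrossable z (uncross x R)"
proof (induction R arbitrary: z x)
  case Nil
  then show ?case using uncrossable_pair[of z x "[]"] by simp
next
  case (Cons r R)
  show ?case
  proof (cases "pos r < pos (lower_half x)")
    case True
    then show ?thesis using Cons.prems uncrossable_pair[of z x "r # R"] by simp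
  next
    case False
    with Cons.prems have x: "fst x \<ge> 3" by (auto intro: uncross_size)
    from False Cons.prems have xr: "gap_ok x r" and nf: "\<not> forbidden z x r"
      and Vd: "uncrossable (down x) R"
      and ur: "gap_ok (up r) (hd (uncross (down x) R))" and pr: "prim r" and sR: "descending R" by auto
    have zu: "gap_ok z (up r)"
      using Cons.prems False by (intro gap_ok_up_sec[of z x r]) auto
    then have z: "fst z \<ge> 2" using gap_ok_fst_prim[of z "up r"] pr by auto
    show ?thesis
    proof (cases "pos (up r) < pos (lower_half z)")
      case True
      then show ?thesis using False by simp
    next
      case F2: False
      have "R = [] \<or> \<not> forbidden (down z) (down x) (hd R)"
      proof (cases R)
        case (Cons s R')
        \<comment> \<open>The exclusion must be passed on to the lowered parts. Otherwise
          \<open>s\<close> would be crossed as well, so \<open>r\<close> and \<open>s\<close> would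
          be a gap apart, for which the pattern leaves no room.\<close>
        have "\<not> forbidden (down z) (down x) s"
        proof
          assume f: "forbidden (down z) (down x) s"
          then have "\<not> pos s < pos (lower_half (down x))" by (rule forbidden_lower_half)
          then have "gap_ok (up r) (up s)" using ur Cons by simp
          then show False using forbidden_down_down[OF f pr zu xr] by (simp add: gap_ok_up_up)
        qed
        then show ?thesis using Cons by simp
      qed simp
      then have "uncrossable (down z) (uncross (down x) R)"
        using Cons.prems x z Vd sR by (intro Cons.IH) (auto simp: gap_ok_down_down)
      moreover have "gap_ok (up (up r)) (hd (uncross (down z) (uncross (down x) R)))"
        using F2 ur z pr Cons.prems x Vd sR by (intro gap_ok_up_uncross descending_uncross) auto
      ultimately show ?thesis using False zu by simp
    qed
  qed
qed

section \<open>Coherent states and their stability under uncrossing\<close>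

definition resting :: "part list \<Rightarrow> part list \<Rightarrow> bool" where
  "resting L R \<longleftrightarrow> rev_admissible L \<and> coherent L R"

text \<open>A moving state is described through the primary word \<open>uncross x R\<close> it comes
  from. A crossing then merely transfers one letter from \<open>L\<close> to this word.\<close>

definition moving :: "part list \<Rightarrow> part \<Rightarrow> part list \<Rightarrow> bool" where
  "moving L x R \<longleftrightarrow> rev_admissible L \<and> descending R \<and> \<not> prim x \<and> fst x \<ge> 2 \<and> uncrossable x R \<and>
    coherent L (uncross x R) \<and> fits L (hd (uncross x R))"

lemma coherent_descending: "coherent L R \<Longrightarrow> descending R"
proof (induction L arbitrary: R)
  case (Cons x L)
  then show ?case by (cases "prim x") fastforce+
qed simp

lemma rev_admissible_append: "rev_admissible (M @ L) \<Longrightarrow> rev_admissible L"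
  by (induction M) auto

text \<open>The head is \<open>upper_half x\<close> or \<open>up r\<close>, and its gap to the
  preceding letter is inherited from \<open>x\<close>. For \<open>up r\<close> after a secondary
  letter this uses that no forbidden triple ends at \<open>r\<close>.\<close>

lemma hd_uncross_fits:
  assumes "rev_admissible (x # L)" "\<not> prim x" "uncrossable x R" "descending R" "R = [] \<or>
    fits (x # L) (hd R)"
  shows "fits L (hd (uncross x R))"
proof -
  have x: "fst x \<ge> 2" "fits L x" using assms by (auto dest!: fits_sized simp: sized_sec)
  have xr: "gap_ok x (hd R)" if "R \<noteq> []" using assms(5) that by (auto dest: fits_gap_ok)
  show ?thesis
  proof (cases "R = [] \<or> pos (hd R) < pos (lower_half x)")
    case True
    then have hd: "hd (uncross x R) = upper_half x" by (simp add: uncross_stop)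
    have sz: "sized (upper_half x)" using x fst_upper_half_ge by (simp add: sized_prim)
    show ?thesis
    proof (cases L)
      case Nil
      then show ?thesis using hd sz by simp
    next
      case (Cons z L')
      have zx: "gap_ok z x" using x Cons by (auto dest: fits_gap_ok)
      then have "gap_ok z (upper_half x)" using x assms gap_ok_upper_half_prim gap_ok_upper_half_sec
        by blast
      moreover have "\<not> forbidden w z (upper_half x)" for w using forbidden_upper_half zx x assms
        by blast
      ultimately show ?thesis using hd sz Cons by (cases L') auto
    qed
  next
    case False
    then obtain r R' where R: "R = r # R'" by (cases R) auto
    then have hd: "hd (uncross x R) = up r" using False by simp
    have r: "prim r" "fst r \<ge> 1" "gap_ok x r" using assms R xr by auto
    have sz: "sized (up r)" using r by (simp add: sized_prim)
    show ?thesis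
    proof (cases L)
      case Nil
      then show ?thesis using hd sz by simp
    next
      case (Cons z L')
      have zx: "gap_ok z x" using x Cons by (auto dest: fits_gap_ok)
      have nf: "\<not> forbidden z x r" using assms(5) R Cons by (cases L') auto
      have "gap_ok z (up r)"
      proof (cases "prim z")
        case True
        then show ?thesis using zx r gap_ok_up_prim by blast
      next
        case False': False
        then show ?thesis using zx r x nf assms False R gap_ok_up_sec[of z x r] by simp
      qed
      moreover have "\<not> forbidden w z (up r)" for w using forbidden_up' zx r assms by blast
      ultimately show ?thesis using hd sz Cons by (cases L') auto
    qed
  qed
qed

text \<open>Each letter \<open>q\<close> of \<open>Q\<close> lowers \<open>z\<close> by one, and the
  triangle inequality through \<open>q\<close> keeps it a gap before the next letter. The last
  hypothesis quantifies over \<open>z'\<close> because the size with which \<open>z\<close> reaches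
  \<open>U\<close> depends on \<open>Q\<close>.\<close>

lemma uncrossable_primaries:
  "\<not> prim z \<Longrightarrow> fst z \<ge> 1 \<Longrightarrow> descending (Q @ U) \<Longrightarrow> successively gap_ok (z # Q) \<Longrightarrow>
    U = [] \<or> Q \<noteq> [] \<and> gap_ok (last Q) (hd U) \<and> (\<forall>z'. \<not> prim z' \<longrightarrow> fst z' \<ge> 1 \<longrightarrow>
      gap_ok (up z') (last Q) \<longrightarrow> uncrossable z' U) \<Longrightarrow>
    uncrossable z (Q @ U)"
proof (induction Q arbitrary: z)
  case Nil
  then show ?case by simp
next
  case (Cons q Q)
  show ?case
  proof (cases "pos q < pos (lower_half z)")
    case False
    have zq: "gap_ok z q" and q: "prim q" "descending (Q @ U)" using Cons.prems by auto
    have z2: "fst z \<ge> 2" using gap_ok_fst_prim[of z q] zq q Cons.prems(3) by auto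
    have next_q: "Q @ U = [] \<or> gap_ok q (hd (Q @ U))" using Cons.prems by (cases Q) auto
    have "uncrossable (down z) (Q @ U)"
    proof (cases Q)
      case Nil
      then consider "U = []" | "gap_ok q (hd U)" "\<And>z'. \<not> prim z' \<Longrightarrow> fst z' \<ge> 1 \<Longrightarrow> gap_ok (up z') q \<Longrightarrow>
        uncrossable z' U"
        using Cons.prems(5) by auto
      then show ?thesis
      proof cases
        case 1
        then show ?thesis using Nil by simp
      next
        case 2
        then show ?thesis using 2(2)[of "down z"] Cons.prems(1) z2 zq Nil by simp
      qed
    next
      case (Cons q' Q')
      have "gap_ok (down z) q'" using gap_ok_down[of q z q'] zq q next_q Cons by simp
      then show ?thesis using Cons.prems z2 q Cons by (intro Cons.IH) auto
    qed
    moreover have "gap_ok (up q) (hd (uncross (down z) (Q @ U)))"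
      using False next_q z2 q by (intro gap_ok_up_uncross) auto
    ultimately show ?thesis using zq by simp
  qed simp
qed

lemma rev_admissible_successively: "rev_admissible M \<Longrightarrow> successively gap_ok (rev M)"
proof (induction M)
  case (Cons y M)
  then show ?case by (cases M) (auto simp: successively_append_iff dest: fits_gap_ok)
qed simp


lemma rev_admissible_sized: "rev_admissible M \<Longrightarrow> x \<in> set M \<Longrightarrow> sized x"
  by (induction M) (auto dest: fits_sized)

lemma descending_append:
  "\<forall>q\<in>set Q. prim q \<and> sized q \<Longrightarrow> successively gap_ok Q \<Longrightarrow> descending U \<Longrightarrow>
    Q = [] \<or> U = [] \<or> gap_ok (last Q) (hd U) \<Longrightarrow> descending (Q @ U)"
proof (induction Q)
  case (Cons q Q)
  have prim_hd: "prim (hd U)" if "U \<noteq> []" using that Cons.prems(3) by (cases U) auto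
  show ?case
  proof (cases Q)
    case Nil
    have "pos (hd U) < pos q" if "U \<noteq> []"
      using that Cons.prems Nil prim_hd[OF that] by (simp add: gap_ok_prim)
    then show ?thesis using Cons.prems Nil by (auto simp: sized_def)
  next
    case (Cons q' Q')
    then show ?thesis using Cons.prems Cons.IH by (auto simp: sized_def gap_ok_prim)
  qed
qed simp

text \<open>With \<open>Q\<close> empty: every admissible word gives a final state. \<open>Q\<close>
  collects the primary letters that \<open>coherent\<close> has stripped off so far.\<close>

lemma coherent_Nil:
  "rev_admissible (rev Q @ L) \<Longrightarrow> \<forall>q\<in>set Q. prim q \<Longrightarrow> coherent L Q"
proof (induction L arbitrary: Q)
  case Nil
  then show ?case
    using descending_append[of Q "[]"] rev_admissible_successively[of "rev Q"] rev_admissible_sized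
      by fastforce
next
  case (Cons z L)
  show ?case
  proof (cases "prim z")
    case True
    then show ?thesis using Cons.prems Cons.IH[of "z # Q"] by simp
  next
    case False
    have su: "successively gap_ok (z # Q)"
      using rev_admissible_successively[OF Cons.prems(1)] by (simp add: successively_append_iff)
    have sQ: "descending Q"
      using su Cons.prems rev_admissible_sized[OF Cons.prems(1)] descending_append[of Q "[]"]
        by (auto simp: successively_Cons)
    have "sized z" using rev_admissible_sized[OF Cons.prems(1)] by simp
    then have "uncrossable z Q"
      using uncrossable_primaries[of z Q "[]"] False sQ su by (simp add: sized_def)
    moreover have "fits (z # L) (hd Q)" if "Q \<noteq> []"
    proof -
      from that obtain q Q' where "Q = q # Q'" by (cases Q) auto
      then show ?thesis using Cons.prems(1) rev_admissible_append[of "rev Q'" "q # z # L"] by simp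
    qed
    ultimately show ?thesis using False sQ by auto
  qed
qed

text \<open>The key to undoing a stop. \<open>Q\<close> again collects the stripped letters; the
  nearest secondary letter \<open>z\<close> before \<open>x\<close> is where coherence has to be
  checked.\<close>

lemma coherent_uncross:
  "rev_admissible (x # rev Q @ L) \<Longrightarrow> \<forall>q\<in>set Q. prim q \<Longrightarrow> \<not> prim x \<Longrightarrow> uncrossable x R \<Longrightarrow> descending R \<Longrightarrow>
    R = [] \<or> fits (x # rev Q @ L) (hd R) \<Longrightarrow> coherent L (Q @ uncross x R)"
proof (induction L arbitrary: Q)
  have sz: "fst x \<ge> 2" if "rev_admissible (x # M)" "\<not> prim x" for M
    using that by (auto dest: fits_sized simp: sized_sec)
  have last_hd: "Q = [] \<or> gap_ok (last Q) (hd (uncross x R))"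
    if "rev_admissible (x # rev Q @ L)" "\<not> prim x" "uncrossable x R" "descending R" "R = [] \<or>
      fits (x # rev Q @ L) (hd R)" for Q L
    using hd_uncross_fits[OF that] by (cases Q rule: rev_cases) (auto dest: fits_gap_ok)
  have sQ: "descending (Q @ uncross x R)"
    if "rev_admissible (x # rev Q @ L)" "\<not> prim x" "uncrossable x R" "descending R" "R = [] \<or>
      fits (x # rev Q @ L) (hd R)" "\<forall>q\<in>set Q. prim q" for Q L
  proof (rule descending_append)
    show "\<forall>q\<in>set Q. prim q \<and> sized q" using that rev_admissible_sized[OF that(1)] by simp
    show "successively gap_ok Q"
      using rev_admissible_successively[OF that(1)] by (simp add: successively_append_iff)
    show "descending (uncross x R)" using that sz[OF that(1,2)] by (intro descending_uncross) auto
  qed (use last_hd[OF that(1-5)] in auto)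
  {
    case Nil
    then show ?case using sQ[of Q "[]"] by simp
  next
    case (Cons z L)
    note prems = Cons.prems
    show ?case
    proof (cases "prim z")
      case True
      then show ?thesis using Cons.prems Cons.IH[of "z # Q"] by simp
    next
      case False
      have su: "successively gap_ok (z # Q @ [x])"
        using rev_admissible_successively[OF prems(1)] by (simp add: successively_append_iff)
      have z: "fst z \<ge> 1" using rev_admissible_sized[OF prems(1)] by (simp add: sized_def)
      have x: "fst x \<ge> 2" using sz prems by blast
      have sQ': "descending (Q @ uncross x R)" using sQ prems by blast
      have "uncrossable z (Q @ uncross x R) \<and> fits (z # L) (hd (Q @ uncross x R))"
      proof (cases Q rule: rev_cases)
        case Nil
        \<comment> \<open>Here \<open>x\<close> directly follows \<open>z\<close>, so admissibility
          itself excludes the pattern.\<close>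
        have "R = [] \<or> \<not> forbidden z x (hd R)" using prems Nil by (cases R) auto
        then have "uncrossable z (uncross x R)" using False prems x z su Nil
          by (intro uncrossable_uncross) auto
        moreover have "fits (z # L) (hd (uncross x R))" using prems Nil by (intro hd_uncross_fits) auto
        ultimately show ?thesis using Nil by simp
      next
        case (snoc Q' q)
        have "successively gap_ok ((z # Q) @ [x])" using su by simp
        then have qx: "gap_ok q x" and suQ: "successively gap_ok (z # Q)"
          unfolding successively_append_iff using snoc by simp_all
        have q: "prim q" using snoc prems by simp
        \<comment> \<open>\<open>z'\<close> stands for \<open>z\<close> on arrival at
          \<open>uncross x R\<close>. The gaps around the primary \<open>q\<close> separate it from
          \<open>x\<close> and exclude a forbidden pattern.\<close>
        have "uncrossable z' (uncross x R)" if "\<not> prim z'" "fst z' \<ge> 1" "gap_ok (up z') q" for z'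
        proof (rule uncrossable_uncross)
          show "gap_ok z' x" using gap_ok_down[OF q that(3) qx] by simp
          show "R = [] \<or> \<not> forbidden z' x (hd R)"
            using forbidden_down[of "up z'" x "hd R" q] q that(3) qx by auto
        qed (use that prems x in auto)
        then have "uncrossable z (Q @ uncross x R)"
          using False z sQ' suQ last_hd[OF prems(1,3-6)] snoc by (intro uncrossable_primaries) auto
        moreover have "Q \<noteq> []" using snoc by simp
        then obtain q' Q'' where "Q = q' # Q''" by (meson neq_Nil_conv)
        then have "fits (z # L) (hd (Q @ uncross x R))"
          using prems(1) rev_admissible_append[of "x # rev Q''" "q' # z # L"] by simp
        ultimately show ?thesis by blast
      qed
      then show ?thesis using False sQ' by simp
    qed
  }
qed

section \<open>Merging two primary parts, the inverse of taking halves\<close>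

fun mix :: "color \<Rightarrow> color \<Rightarrow> color" where
  "mix Ca Cb = Cab" | "mix Ca Cc = Cac" | "mix Ca Cd = Cad" | "mix Cb Cc = Cbc" | "mix Cb Cd = Cbd"
| "mix Cc Cd = Ccd" | "mix Cb Ca = Cab" | "mix Cc Ca = Cac" | "mix Cd Ca = Cad" | "mix Cc Cb = Cbc"
| "mix Cd Cb = Cbd" | "mix Cd Cc = Ccd" | "mix p _ = p"

definition merge :: "part \<Rightarrow> part \<Rightarrow> part" where
  "merge p r = (fst p + fst r, mix (snd p) (snd r))"

text \<open>Different positions less than 4 apart force distinct colors and sizes that are equal or
  consecutive, so \<open>p\<close> and \<open>r\<close> are the halves of their sum.\<close>

lemma
  assumes "prim p" "prim r" "pos r < pos p" "pos p < pos r + 4"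
  shows merge_sec: "\<not> prim (merge p r)" and upper_half_merge: "upper_half (merge p r) = p"
    and lower_half_merge: "lower_half (merge p r) = r"
proof -
  obtain k c l e where [simp]: "p = (k, c)" "r = (l, e)" by (cases p; cases r)
  have "k = l \<or> k = l + 1" using assms by (cases c; cases e; simp add: pos_def; linarith)
  then have "\<not> prim (merge p r) \<and> upper_half (merge p r) = p \<and> lower_half (merge p r) = r"
    using assms by (elim disjE; cases c; cases e;
      simp add: is_primary_def merge_def upper_half_def lower_half_def pos_def)
  then show "\<not> prim (merge p r)" "upper_half (merge p r) = p" "lower_half (merge p r) = r" by auto
qed

lemma merge_upper_half_lower_half: "\<not> prim x \<Longrightarrow> merge (upper_half x) (lower_half x) = x"
  by (cases x; cases "snd x"; cases "fst x" rule: even_odd_cases;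
    simp add: merge_def upper_half_def lower_half_def is_primary_def)

section \<open>The moves\<close>

lemma resting_move:
  assumes "resting L (r # R)" "fits L r"
  shows "resting (r # L) R"
proof -
  have "prim r" using assms coherent_descending[of L "r # R"] by (auto simp: resting_def)
  then show ?thesis using assms by (simp add: resting_def)
qed

text \<open>By coherence \<open>r\<close> would fit after a secondary letter, so the last letter
  \<open>p\<close> is primary. Descent and the failure to fit place \<open>pos p\<close> strictly
  between \<open>pos r\<close> and \<open>pos r + 4\<close>, as a merge requires.\<close>

lemma resting_merge:
  assumes "resting L (r # R)" "\<not> fits L r"
  shows "\<exists>p L'. L = p # L' \<and> prim p \<and> moving L' (merge p r) R \<and> upper_half (merge p r) = p \<and>
    lower_half (merge p r) = r \<and>
    (R = [] \<or> pos (hd R) < pos r)"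
proof (cases L)
  case Nil
  then show ?thesis using assms by (auto simp: resting_def sized_prim)
next
  case (Cons p L')
  have coherent: "coherent (p # L') (r # R)" and rL: "rev_admissible (p # L')" using assms(1) Cons
    unfolding resting_def by blast+
  have r: "prim r" "fst r \<ge> 1" "R = [] \<or> pos (hd R) < pos r" "descending R"
    using coherent_descending[OF coherent] by auto
  have p: "prim p"
  proof (rule ccontr)
    assume np: "\<not> prim p"
    have "fits (p # L') r" using coherent np by simp
    then show False using assms Cons by simp
  qed
  have "pos r < pos p" using coherent_descending[of L' "p # r # R"] coherent p by simp
  moreover have "pos p < pos r + 4"
    using assms(2) Cons p r by (simp add: fits_prim_last sized_prim gap_ok_prim)
  ultimately have m: "\<not> prim (merge p r)" "upper_half (merge p r) = p" "lower_half (merge p r) = r"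
    using merge_sec upper_half_merge lower_half_merge p r by auto
  have "fst (merge p r) \<ge> 2"
    using rL r p rev_admissible_sized[OF rL, of p] by (simp add: merge_def sized_prim)
  then have "moving L' (merge p r) R"
    unfolding moving_def using rL r coherent p m by (auto simp: uncross_stop intro: uncrossable_stop)
  then show ?thesis using Cons p m r by blast
qed

lemma moving_stop:
  assumes "moving L x R" "fits L x"
  shows "resting (x # L) R"
proof -
  have I: "rev_admissible L" "descending R" "\<not> prim x" "fst x \<ge> 2" "uncrossable x R"
    "coherent L (uncross x R)" "fits L (hd (uncross x R))"
    using assms by (auto simp: moving_def)
  have "fits (x # L) (hd R)" if "R \<noteq> []"
  proof -
    from that obtain r R' where R: "R = r # R'" by (cases R) auto
    have r: "prim r" "fst r \<ge> 1" using I R by auto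
    have xr: "gap_ok x r" using I R r gap_ok_lower_half[of x r] by auto
    \<comment> \<open>In a forbidden triple \<open>r\<close> is a crossed letter, so
      \<open>up r\<close> stood legally after \<open>z\<close>, contrary to
      \<open>forbidden_up\<close>.\<close>
    have "\<not> forbidden z x r" if "L = z # L'" for z L'
    proof
      assume f: "forbidden z x r"
      then have "hd (uncross x R) = up r" using forbidden_lower_half R by simp
      then have "gap_ok z (up r)" using I that by (auto dest: fits_gap_ok)
      then show False using forbidden_up f by blast
    qed
    then show ?thesis using xr r R by (cases L) (auto simp: sized_prim)
  qed
  then show ?thesis using I assms by (auto simp: resting_def)
qed

lemma moving_cross:
  assumes "moving L x R" "\<not> fits L x"
  shows "\<exists>p L'. L = p # L' \<and> prim p \<and> fst p \<ge> 1 \<and> moving L' (up x) (down p # R) \<and>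
    \<not> pos (down p) < pos (lower_half (up x))"
proof (cases L)
  case Nil
  then show ?thesis using assms by (auto simp: moving_def sized_sec)
next
  case (Cons p L')
  have I: "rev_admissible L" "descending R" "\<not> prim x" "fst x \<ge> 2" "uncrossable x R"
    "coherent L (uncross x R)" "fits L (hd (uncross x R))"
    using assms by (auto simp: moving_def)
  have szp: "sized p" using rev_admissible_sized[OF I(1), of p] Cons by simp
  have npx: "\<not> gap_ok p x" using assms(2) I Cons by (simp add: fits_sec sized_sec)
  have p: "prim p"
  proof (rule ccontr)
    assume np: "\<not> prim p"
    then have "gap_ok p x"
      using I Cons szp by (intro uncrossable_uncross_gap_ok[of p x R]) (auto simp: sized_def)
    then show False using npx by simp
  qed
  have p1: "fst p \<ge> 1" using szp p by (simp add: sized_prim)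
  have phd: "gap_ok p (hd (uncross x R))" using I Cons by (auto dest: fits_gap_ok)
  have hl: "pos (lower_half x) < pos (upper_half x)" "pos (upper_half x) < pos (lower_half x) + 4"
    using I upper_half_gt_lower_half upper_half_lt_lower_half by auto
  \<comment> \<open>The first bound makes the new state recognizable as a crossing, the second keeps
    \<open>down p # R\<close> descending.\<close>
  have "pos (upper_half x) + 4 \<le> pos p \<and> (R = [] \<or> pos (hd R) + 4 < pos p)"
  proof (cases "R = [] \<or> pos (hd R) < pos (lower_half x)")
    case True
    then have "pos (upper_half x) + 4 \<le> pos p" using phd p by (simp add: uncross_stop gap_ok_prim)
    then show ?thesis using True hl by auto
  next
    case False
    then obtain r R' where R: "R = r # R'" by (cases R) auto
    then have "pos r + 8 \<le> pos p" using phd p False I by (simp add: gap_ok_prim)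
    then show ?thesis using hl False R by auto
  qed
  then have pos_p: "pos (upper_half x) + 4 \<le> pos p" "R = [] \<or> pos (hd R) + 4 < pos p" by auto
  have "4 * 1 \<le> pos (upper_half x)" using pos_ge[of "upper_half x"] fst_upper_half_ge[of x] I
    by linarith
  then have p2: "fst p \<ge> 2" using fst_ge_of_pos[of 2 p] pos_p by linarith
  have ns: "\<not> pos (down p) < pos (lower_half (up x))" using pos_p p1
    by (simp add: lower_half_up pos_down)
  have descending': "descending (down p # R)" using p p2 pos_p I by (auto simp: pos_down)
  \<comment> \<open>Coherence carries over, since \<open>coherent\<close> shifts the primary
    \<open>p\<close> to the right word in just this way.\<close>
  have uncross': "uncross (up x) (down p # R) = p # uncross x R" using ns p1 by simp
  have xp: "gap_ok (up x) (down p)" using gap_ok_cross[of "up x" "down p"] npx I p p1 by simp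
  have uncrossable': "uncrossable (up x) (down p # R)" using xp I phd p1 by simp
  have "moving L' (up x) (down p # R)"
    unfolding moving_def uncross' using I Cons p descending' uncrossable' by auto
  then show ?thesis using Cons p p1 ns by blast
qed

lemma resting_unmove: "resting (p # L) R \<Longrightarrow> prim p \<Longrightarrow> resting L (p # R) \<and> fits L p"
  by (simp add: resting_def)

lemma resting_unstop:
  assumes "resting (x # L) R" "\<not> prim x"
  shows "moving L x R \<and> fits L x"
proof -
  have I: "rev_admissible (x # L)" "descending R" "uncrossable x R" "R = [] \<or> fits (x # L) (hd R)"
    using assms by (auto simp: resting_def)
  have "coherent L (uncross x R)" using coherent_uncross[of x "[]" L R] I assms by simp
  moreover have "fits L (hd (uncross x R))" using hd_uncross_fits I assms by blast
  moreover have "fst x \<ge> 2" using rev_admissible_sized[OF I(1), of x] assms by (simp add: sized_sec)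
  ultimately show ?thesis using I assms by (auto simp: moving_def)
qed

lemma moving_unmerge:
  assumes "moving L x R" "R = [] \<or> pos (hd R) < pos (lower_half x)"
  shows "resting (upper_half x # L) (lower_half x # R) \<and> \<not> fits (upper_half x # L) (lower_half x)"
proof -
  have "\<not> gap_ok (upper_half x) (lower_half x)" using assms upper_half_lt_lower_half[of x]
    by (simp add: gap_ok_prim moving_def)
  then have "\<not> fits (upper_half x # L) (lower_half x)" using fits_gap_ok by blast
  moreover have "resting (upper_half x # L) (lower_half x # R)" using assms
    by (auto simp: resting_def moving_def uncross_stop)
  ultimately show ?thesis by blast
qed

text \<open>The failure to fit, from \<open>gap_ok_cross\<close>, makes \<open>move\<close> take the
  crossing again.\<close>

lemma moving_uncross:
  assumes "moving L x (r # R)" "\<not> pos r < pos (lower_half x)"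
  shows "moving (up r # L) (down x) R \<and> \<not> fits (up r # L) (down x) \<and> fst x \<ge> 1"
proof -
  have I: "rev_admissible L" "descending (r # R)" "\<not> prim x" "fst x \<ge> 2" "uncrossable x (r # R)"
    "coherent L (uncross x (r # R))"
    "fits L (hd (uncross x (r # R)))" using assms by (auto simp: moving_def)
  have x3: "fst x \<ge> 3" using I assms by (auto intro: uncross_size)
  have "\<not> gap_ok (up r) (down x)" using gap_ok_cross[of x r] I assms by simp
  then have "\<not> fits (up r # L) (down x)" using fits_gap_ok by blast
  moreover have "sized (hd (uncross (down x) R))"
    using descending_uncross[of "down x" R] I assms x3
      by (cases "uncross (down x) R") (auto simp: sized_prim)
  then have "moving (up r # L) (down x) R"
    using I assms x3 by (auto simp: moving_def fits_prim_last)
  ultimately show ?thesis using I by auto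
qed

section \<open>States with at most one moving part, and the two inverse maps\<close>

type_synonym state = "part list \<times> part option \<times> part list"

fun valid :: "state \<Rightarrow> bool" where
  "valid (L, None, R) = resting L R"
| "valid (L, Some x, R) = moving L x R"

fun move :: "state \<Rightarrow> state" where
  "move (L, None, R) =
     (if fits L (hd R) then (hd R # L, None, tl R) else (tl L, Some (merge (hd L) (hd R)), tl R))"
| "move (L, Some x, R) =
     (if fits L x then (x # L, None, R) else (tl L, Some (up x), down (hd L) # R))"

fun unmove :: "state \<Rightarrow> state" where
  "unmove (L, None, R) =
     (if prim (hd L) then (tl L, None, hd L # R) else (tl L, Some (hd L), R))"
| "unmove (L, Some x, R) =
     (if R = [] \<or> pos (hd R) < pos (lower_half x) then (upper_half x # L, None, lower_half x # R)
      else (up (hd R) # L, Some (down x), tl R))"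

definition starting :: "state \<Rightarrow> bool" where "starting s \<longleftrightarrow> fst s = [] \<and> fst (snd s) = None"
definition finished :: "state \<Rightarrow> bool" where "finished s \<longleftrightarrow> snd (snd s) = [] \<and> fst (snd s) = None"

definition parts :: "state \<Rightarrow> part list" where
  "parts s = (case s of (L, y, R) \<Rightarrow> rev L @ (case y of None \<Rightarrow> [] | Some x \<Rightarrow> [x]) @ R)"

definition weight :: "part list \<Rightarrow> nat" where "weight xs = sum_list (map fst xs)"

lemma weight_simps [simp]: "weight [] = 0" "weight (x # xs) = fst x + weight xs" "weight (xs @ ys) =
  weight xs + weight ys"
  by (simp_all add: weight_def)

lemma num_parts_simps [simp]: "num_parts i [] = 0"
  "num_parts i (x # xs) = of_bool (i \<in> primaries (snd x)) + num_parts i xs"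
  "num_parts i (xs @ ys) = num_parts i xs + num_parts i ys"
  by (auto simp: num_parts_def split: prod.splits)

lemma primaries_lower_half_upper_half: "\<not> prim x \<Longrightarrow>
   of_bool (i \<in> primaries (snd (lower_half x))) + of_bool (i \<in> primaries (snd (upper_half x))) =
     (of_bool (i \<in> primaries (snd x)) :: nat)"
  by (cases "snd x"; cases i; simp add: lower_half_def upper_half_def is_primary_def)

lemma unmove_move:
  assumes "valid s" "\<not> finished s"
  shows "valid (move s) \<and> \<not> starting (move s) \<and> unmove (move s) = s \<and>
     weight (parts (move s)) = weight (parts s) \<and> num_parts i (parts (move s)) = num_parts i (parts s)"
proof (cases s)
  case (fields L y R)
  show ?thesis
  proof (cases y)
    case None
    then obtain r R' where R: "R = r # R'" using assms fields by (cases R) (auto simp: finished_def)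
    have I: "resting L (r # R')" using assms fields None R by simp
    have r: "prim r" using I coherent_descending[of L "r # R'"] by (auto simp: resting_def)
    show ?thesis
    proof (cases "fits L r")
      case True
      then show ?thesis using resting_move[OF I True] fields None R r
        by (simp add: starting_def parts_def)
    next
      case False
      obtain p L' where p: "L = p # L'" "prim p" "moving L' (merge p r) R'" "upper_half (merge p r) = p"
        "lower_half (merge p r) = r" "R' = [] \<or> pos (hd R') < pos r"
        using resting_merge[OF I False] by blast
      have "\<not> prim (merge p r)" using p(3) by (simp add: moving_def)
      then have "of_bool (i \<in> primaries (snd r)) + of_bool (i \<in> primaries (snd p)) =
        (of_bool (i \<in> primaries (snd (merge p r))) :: nat)"
        using primaries_lower_half_upper_half[of "merge p r" i] p by simp
      then show ?thesis using p fields None R False by (auto simp: starting_def parts_def merge_def)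
    qed
  next
    case (Some x)
    have I: "moving L x R" using assms fields Some by simp
    show ?thesis
    proof (cases "fits L x")
      case True
      then show ?thesis using moving_stop[OF I True] fields Some I
        by (simp add: starting_def parts_def moving_def)
    next
      case False
      obtain p L' where p: "L = p # L'" "prim p" "fst p \<ge> 1" "moving L' (up x) (down p # R)"
        "\<not> pos (down p) < pos (lower_half (up x))"
        using moving_cross[OF I False] by blast
      then show ?thesis using fields Some False by (simp add: starting_def parts_def)
    qed
  qed
qed

lemma move_unmove:
  assumes "valid s" "\<not> starting s"
  shows "valid (unmove s) \<and> \<not> finished (unmove s) \<and> move (unmove s) = s"
proof (cases s)
  case (fields L y R)
  show ?thesis
  proof (cases y)
    case None
    then obtain p L' where L: "L = p # L'" using assms fields by (cases L) (auto simp: starting_def)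
    have I: "resting (p # L') R" using assms fields None L by simp
    show ?thesis
      using resting_unmove[OF I] resting_unstop[OF I] fields None L by (simp add: finished_def)
  next
    case (Some x)
    have I: "moving L x R" using assms fields Some by simp
    then have x: "\<not> prim x" by (simp add: moving_def)
    show ?thesis
    proof (cases "R = [] \<or> pos (hd R) < pos (lower_half x)")
      case True
      then show ?thesis using moving_unmerge[OF I True] x merge_upper_half_lower_half[of x] fields
        Some by (simp add: finished_def)
    next
      case False
      then obtain r R' where R: "R = r # R'" by (cases R) auto
      then show ?thesis using moving_uncross[of L x r R'] I False fields Some
        by (simp add: finished_def)
    qed
  qed
qed

section \<open>Counting\<close>

lemma fits_rev: "fits (rev xs) y \<longleftrightarrow> sized y \<and> (xs \<noteq> [] \<longrightarrow> gap_ok (last xs) y) \<and>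
   (length xs \<ge> 2 \<longrightarrow> \<not> forbidden (xs ! (length xs - 2)) (last xs) y)"
proof (cases xs rule: rev_cases)
  case (snoc ys x)
  then show ?thesis by (cases ys rule: rev_cases) (auto simp: nth_append)
qed simp

text \<open>Each of the size, gap and pattern conditions gains at most one new instance at the end
  of the word; \<open>fits\<close> collects these instances.\<close>

lemma admissible_snoc: "admissible (xs @ [y]) \<longleftrightarrow> admissible xs \<and> fits (rev xs) y"
proof -
  define S where "S zs \<longleftrightarrow> (\<forall>(k, p) \<in> set zs. k \<ge> 1) \<and> (\<forall>(k, p) \<in> set zs. is_secondary p \<longrightarrow> k \<ge> 2)"
    for zs :: "part list"
  define F where "F zs \<longleftrightarrow> (\<forall>i. i + 1 < length zs \<longrightarrow> gap_ok (zs ! i) (zs ! (i + 1)))" for zs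
  define B where "B zs \<longleftrightarrow> (\<forall>i. i + 2 < length zs \<longrightarrow>
    \<not> forbidden (zs ! i) (zs ! (i + 1)) (zs ! (i + 2)))" for zs
  have adm: "admissible zs \<longleftrightarrow> S zs \<and> F zs \<and> B zs" for zs
    unfolding admissible_def S_def F_def B_def gap_ok_def conj_assoc ..
  have F: "F (xs @ [y]) \<longleftrightarrow> F xs \<and> (xs \<noteq> [] \<longrightarrow> gap_ok (last xs) y)"
    (is "?l0 \<longleftrightarrow> ?r0")
  proof
    assume l: ?l0
    have "gap_ok (xs ! i) (xs ! (i + 1))" if "i + 1 < length xs" for i
      using l[unfolded F_def, rule_format, of i] that by (simp add: nth_append)
    moreover have "gap_ok (last xs) y" if "xs \<noteq> []"
      using l[unfolded F_def, rule_format, of "length xs - 1"] that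
        by (simp add: nth_append last_conv_nth)
    ultimately show ?r0 unfolding F_def by blast
  next
    assume r: ?r0
    show ?l0 unfolding F_def
    proof (intro allI impI)
      fix i assume "i + 1 < length (xs @ [y])"
      then consider "i + 1 < length xs" | "i = length xs - 1" "xs \<noteq> []" by fastforce
      then show "gap_ok ((xs @ [y]) ! i) ((xs @ [y]) ! (i + 1))"
        by cases (use r[unfolded F_def] in \<open>simp_all add: nth_append last_conv_nth\<close>)
    qed
  qed
  have B: "B (xs @ [y]) \<longleftrightarrow> B xs \<and> (length xs \<ge> 2 \<longrightarrow> \<not> forbidden (xs ! (length xs - 2)) (last xs) y)"
    (is "?l0 \<longleftrightarrow> ?r0")
  proof
    assume l: ?l0
    have "\<not> forbidden (xs ! i) (xs ! (i + 1)) (xs ! (i + 2))" if "i + 2 < length xs" for i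
      using l[unfolded B_def, rule_format, of i] that by (simp add: nth_append)
    moreover have "\<not> forbidden (xs ! (length xs - 2)) (last xs) y" if "length xs \<ge> 2"
    proof -
      have "length xs - 2 + 1 = length xs - 1" "length xs - 2 + 2 = length xs" "xs \<noteq> []" using that
        by auto
      then show ?thesis
        using l[unfolded B_def, rule_format, of "length xs - 2"] that
        by (simp add: nth_append last_conv_nth del: One_nat_def)
    qed
    ultimately show ?r0 unfolding B_def by blast
  next
    assume r: ?r0
    show ?l0 unfolding B_def
    proof (intro allI impI)
      fix i assume "i + 2 < length (xs @ [y])"
      then consider "i + 2 < length xs" | "i = length xs - 2" "length xs \<ge> 2" by fastforce
      then show "\<not> forbidden ((xs @ [y]) ! i) ((xs @ [y]) ! (i + 1)) ((xs @ [y]) ! (i + 2))"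
      proof cases
        case 2
        then have "i + 1 = length xs - 1" "i + 2 = length xs" "xs \<noteq> []" by auto
        then show ?thesis using r[unfolded B_def] 2
          by (simp add: nth_append last_conv_nth del: One_nat_def)
      qed (use r[unfolded B_def] in \<open>simp add: nth_append\<close>)
    qed
  qed
  have S: "S (xs @ [y]) \<longleftrightarrow> S xs \<and> sized y"
    unfolding S_def by (cases y) (auto simp: sized_def is_secondary_iff)
  show ?thesis
    unfolding adm fits_rev S F B by (simp only: conj_ac)
qed

lemma admissible_iff_rev_admissible: "admissible xs \<longleftrightarrow> rev_admissible (rev xs)"
proof (induction xs rule: rev_induct)
  case Nil
  then show ?case by (simp add: admissible_def)
next
  case (snoc y xs)
  then show ?case by (auto simp: admissible_snoc)
qed

section \<open>Descending words as quadruples of partitions\<close>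

lemma descending_elem: "descending R \<Longrightarrow> x \<in> set R \<Longrightarrow> prim x \<and> fst x \<ge> 1 \<and> pos x \<le> pos (hd R)"
proof (induction R)
  case (Cons r R)
  show ?case
  proof (cases "x = r")
    case True
    then show ?thesis using Cons.prems by simp
  next
    case False
    then have x: "x \<in> set R" using Cons.prems by simp
    then have "R \<noteq> []" by auto
    then have "pos (hd R) < pos r" "descending R" using Cons.prems by simp_all
    then show ?thesis using Cons.IH x by simp
  qed
qed simp

lemma descending_less:
  assumes "descending (r # R)" "x \<in> set R"
  shows "pos x < pos r"
proof -
  have "R \<noteq> []" using assms by auto
  then have "pos (hd R) < pos r" "descending R" using assms by simp_all
  then show ?thesis using descending_elem[of R x] assms by simp
qed

lemma descending_distinct: "descending R \<Longrightarrow> distinct R"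
proof (induction R)
  case (Cons r R)
  then show ?case using descending_less[of r R r] by auto
qed simp

lemma pos_inj:
  assumes "prim x" "prim y" "pos x = pos y"
  shows "x = y"
proof -
  have "primary_index (snd x) < 4" "primary_index (snd y) < 4"
    by (cases "snd x"; simp) (cases "snd y"; simp)
  then have "fst x = fst y" "primary_index (snd x) = primary_index (snd y)" using assms(3)
    unfolding pos_def by presburger+
  moreover from this have "snd x = snd y"
    using assms by (cases "snd x"; cases "snd y"; simp add: is_primary_def)
  ultimately show ?thesis by (simp add: prod_eq_iff)
qed

lemma descending_unique: "descending R \<Longrightarrow> descending R' \<Longrightarrow> set R = set R' \<Longrightarrow> R = R'"
proof (induction R arbitrary: R')
  case (Cons r R)
  have "R' \<noteq> []" using Cons.prems(3) by auto
  then obtain r' S where R': "R' = r' # S" by (meson neq_Nil_conv)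
  have "r = r'"
  proof (rule ccontr)
    assume "r \<noteq> r'"
    moreover have "r \<in> set (r' # S)" "r' \<in> set (r # R)"
      using Cons.prems(3) R' by (metis list.set_intros(1))+
    ultimately have "r \<in> set S" "r' \<in> set R" by simp_all
    then have "pos r < pos r'" "pos r' < pos r"
      using descending_less[of r R r'] descending_less[of r' S r] Cons.prems(1,2) unfolding R' by blast+
    then show False by simp
  qed
  moreover have "set R = set S"
    using Cons.prems(3) descending_distinct[OF Cons.prems(1)] descending_distinct[OF Cons.prems(2)]
    unfolding R' \<open>r = r'\<close>[symmetric] by (simp add: insert_ident)
  moreover have "descending R" "descending S" using Cons.prems R' by simp_all
  ultimately show ?case using Cons.IH R' by blast
qed simp

lemma descending_exists:
  assumes "finite T" "\<forall>x\<in>T. prim x \<and> fst x \<ge> 1"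
  shows "\<exists>R. descending R \<and> set R = T"
  using assms
\<comment> \<open>Elements are added by increasing \<open>pos\<close>, so a new one goes to the
  front; it may already be present.\<close>
proof (induction T rule: finite_ranking_induct[where f = pos])
  case empty
  then show ?case by (intro exI[of _ "[]"]) auto
next
  case (insert x S)
  have "\<forall>x\<in>S. prim x \<and> fst x \<ge> 1" using insert.prems by blast
  from insert.IH[OF this] obtain R where R: "descending R" "set R = S" by blast
  show ?case
  proof (cases "x \<in> S")
    case True
    then show ?thesis using R by (auto simp: insert_absorb)
  next
    case False
    have "pos y < pos x" if "y \<in> S" for y
    proof -
      have "y \<noteq> x" using that False by auto
      then have "pos y \<noteq> pos x" using pos_inj[of y x] insert.prems that by auto
      then show ?thesis using insert.hyps(2)[OF that] by linarith
    qed
    then have "R = [] \<or> pos (hd R) < pos x" using R(2) by (cases R) auto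
    then have "descending (x # R)" using R(1) insert.prems by simp
    then show ?thesis using R(2) by (intro exI[of _ "x # R"]) simp
  qed
qed

definition of_color :: "color \<Rightarrow> part list \<Rightarrow> nat set" where
  "of_color c R = {k. (k, c) \<in> set R}"

definition of_sets :: "nat set \<times> nat set \<times> nat set \<times> nat set \<Rightarrow> part set" where
  "of_sets = (\<lambda>(P, Q, R, S). (\<lambda>k. (k, Ca)) ` P \<union> (\<lambda>k. (k, Cb)) ` Q \<union> (\<lambda>k. (k, Cc)) ` R \<union> (\<lambda>k. (k, Cd)) ` S)"

lemma set_descending:
  assumes "descending R"
  shows "set R = of_sets (of_color Ca R, of_color Cb R, of_color Cc R, of_color Cd R)"
proof -
  have "(k, c) \<in> of_sets (of_color Ca R, of_color Cb R, of_color Cc R, of_color Cd R) \<longleftrightarrow>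
      is_primary c \<and> (k, c) \<in> set R" for k c
    by (cases c) (auto simp: of_sets_def of_color_def is_primary_def)
  moreover have "is_primary c" if "(k, c) \<in> set R" for k c
    using descending_elem[OF assms that] by simp
  ultimately show ?thesis by auto
qed

lemma finite_of_color: "finite (of_color c R)"
proof -
  have "of_color c R \<subseteq> fst ` set R" by (force simp: of_color_def)
  then show ?thesis by (rule finite_subset) simp
qed

lemma weight_descending:
  assumes "descending R"
  shows "weight R = \<Sum>(of_color Ca R) + \<Sum>(of_color Cb R) + \<Sum>(of_color Cc R) + \<Sum>(of_color Cd R)"
proof -
  have dis: "(\<lambda>k. (k, c)) ` A \<inter> (\<lambda>k. (k, c')) ` B = {}" if "c \<noteq> c'" for c c' :: color
    and A B :: "nat set"
    using that by auto
  have "weight R = sum fst (set R)"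
    unfolding weight_def using descending_distinct[OF assms]
      by (simp add: sum_list_distinct_conv_sum_set)
  also have "\<dots> = sum fst ((\<lambda>k. (k, Ca)) ` of_color Ca R) + sum fst ((\<lambda>k. (k, Cb)) ` of_color Cb R) +
      sum fst ((\<lambda>k. (k, Cc)) ` of_color Cc R) + sum fst ((\<lambda>k. (k, Cd)) ` of_color Cd R)"
    unfolding set_descending[OF assms] of_sets_def prod.case
    using dis by (simp add: sum.union_disjoint Int_Un_distrib2 finite_of_color)
  also have "\<dots> = \<Sum>(of_color Ca R) + \<Sum>(of_color Cb R) + \<Sum>(of_color Cc R) + \<Sum>(of_color Cd R)"
    by (simp add: sum.reindex inj_on_def)
  finally show ?thesis .
qed

lemma num_parts_descending:
  assumes "descending R" "\<And>c. is_primary c \<Longrightarrow> i \<in> primaries c \<longleftrightarrow> c = c0"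
  shows "num_parts i R = card (of_color c0 R)"
proof -
  have "num_parts i R = length (filter (\<lambda>x. snd x = c0) R)"
    unfolding num_parts_def
    by (intro arg_cong[of _ _ length] filter_cong refl) (use assms(2) descending_elem[OF assms(1)]
      in \<open>fastforce\<close>)
  also have "\<dots> = card (set (filter (\<lambda>x. snd x = c0) R))"
    using descending_distinct[OF assms(1)] by (metis distinct_card distinct_filter)
  also have "set (filter (\<lambda>x. snd x = c0) R) = (\<lambda>k. (k, c0)) ` of_color c0 R"
    by (auto simp: of_color_def)
  also have "card \<dots> = card (of_color c0 R)" by (simp add: card_image inj_on_def)
  finally show ?thesis .
qed

definition has_content :: "nat \<Rightarrow> nat \<Rightarrow> nat \<Rightarrow> nat \<Rightarrow> nat \<Rightarrow> part list \<Rightarrow> bool" where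
  "has_content u v w t n xs \<longleftrightarrow> weight xs = n \<and> num_parts Pa xs = u \<and> num_parts Pb xs = v \<and>
     num_parts Pc xs = w \<and> num_parts Pd xs = t"

lemma has_content_descending:
  assumes "descending R"
  shows "has_content u v w t n R \<longleftrightarrow>
    \<Sum>(of_color Ca R) + \<Sum>(of_color Cb R) + \<Sum>(of_color Cc R) + \<Sum>(of_color Cd R) = n \<and>
    card (of_color Ca R) = u \<and> card (of_color Cb R) = v \<and> card (of_color Cc R) = w \<and>
      card (of_color Cd R) = t"
proof -
  have "num_parts Pa R = card (of_color Ca R)" "num_parts Pb R = card (of_color Cb R)"
    "num_parts Pc R = card (of_color Cc R)" "num_parts Pd R = card (of_color Cd R)"
    by (rule num_parts_descending[OF assms], auto simp: is_primary_def)+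
  then show ?thesis unfolding has_content_def weight_descending[OF assms] by simp
qed

text \<open>A descending word is determined by its set of letters, and every finite set of primary
  parts arises; splitting by color gives the quadruple.\<close>

lemma count_A_eq: "count_A u v w t n = card {R. descending R \<and> has_content u v w t n R}"
proof -
  let ?f = "\<lambda>R. (of_color Ca R, of_color Cb R, of_color Cc R, of_color Cd R)"
  have pos_elem: "k \<ge> 1" if "descending R" "k \<in> of_color c R" for k c R
    using descending_elem[OF that(1), of "(k, c)"] that by (simp add: of_color_def)
  have "bij_betw ?f {R. descending R \<and> has_content u v w t n R}
     {(P, Q, R, S). P \<in> distinct_partitions u \<and> Q \<in> distinct_partitions v \<and>
                    R \<in> distinct_partitions w \<and> S \<in> distinct_partitions t \<and> \<Sum>P + \<Sum>Q + \<Sum>R + \<Sum>S = n}"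
    (is "bij_betw _ ?A ?B")
    unfolding bij_betw_def
  proof
    show "inj_on ?f ?A"
    proof (rule inj_onI)
      fix R R' assume "R \<in> ?A" "R' \<in> ?A" and eq: "?f R = ?f R'"
      then have R: "descending R" "descending R'" by simp_all
      then show "R = R'" using eq by (intro descending_unique) (simp_all only: set_descending[OF
        R(1)] set_descending[OF R(2)])
    qed
    show "?f ` ?A = ?B"
    proof
      show "?f ` ?A \<subseteq> ?B"
      proof (rule image_subsetI)
        fix R assume "R \<in> ?A"
        then have R: "descending R" "has_content u v w t n R" by simp_all
        show "?f R \<in> ?B"
          using R(2) pos_elem[OF R(1)] unfolding has_content_descending[OF R(1)] distinct_partitions_def
          by (simp add: finite_of_color)
      qed
      show "?B \<subseteq> ?f ` ?A"
      proof
        fix z assume zB: "z \<in> ?B"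
        obtain P Q R S where z: "z = (P, Q, R, S)" by (rule prod_cases4)
        have B: "P \<in> distinct_partitions u" "Q \<in> distinct_partitions v"
          "R \<in> distinct_partitions w" "S \<in> distinct_partitions t" "\<Sum>P + \<Sum>Q + \<Sum>R + \<Sum>S = n"
          using zB unfolding z by simp_all
        have "finite (of_sets z)" "\<forall>x\<in>of_sets z. prim x \<and> fst x \<ge> 1"
          using B(1-4) unfolding z of_sets_def distinct_partitions_def by (auto simp: is_primary_def)
        then obtain L where L: "descending L" "set L = of_sets z" using descending_exists by blast
        have eq: "of_color Ca L = P" "of_color Cb L = Q" "of_color Cc L = R" "of_color Cd L = S"
          unfolding of_color_def L(2) z of_sets_def by auto
        have "L \<in> ?A"
          using B L(1) has_content_descending[OF L(1), of u v w t n] unfolding eq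
            by (simp add: distinct_partitions_def)
        then show "z \<in> ?f ` ?A" unfolding z by (intro image_eqI[of _ _ L]) (simp_all only: eq)
      qed
    qed
  qed
  from bij_betw_same_card[OF this] show ?thesis unfolding count_A_def by (rule sym)
qed

section \<open>Finiteness of the state space and cancellation\<close>

lemma weight_bounds:
  assumes "\<forall>x\<in>set xs. 1 \<le> fst x"
  shows "length xs \<le> weight xs" "x \<in> set xs \<Longrightarrow> fst x \<le> weight xs"
  using assms by (induction xs) auto

lemma valid_parts:
  assumes "valid s"
  shows "\<forall>x\<in>set (parts s). 1 \<le> fst x"
proof (cases s)
  case (fields L y R)
  show ?thesis
  proof (cases y)
    case None
    then have "resting L R" using assms fields by simp
    then have "rev_admissible L" "descending R" using coherent_descending by (auto simp: resting_def)
    then show ?thesis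
      using fields None rev_admissible_sized[of L] descending_elem[of R]
        by (auto simp: parts_def sized_def)
  next
    case (Some x)
    then have "moving L x R" using assms fields by simp
    then have "rev_admissible L" "descending R" "fst x \<ge> 2" by (auto simp: moving_def)
    then show ?thesis
      using fields Some rev_admissible_sized[of L] descending_elem[of R]
        by (auto simp: parts_def sized_def)
  qed
qed

lemma UNIV_color: "UNIV = {Ca, Cb, Cc, Cd, Cab, Cac, Cad, Cbc, Cbd, Ccd}"
proof -
  have "c \<in> {Ca, Cb, Cc, Cd, Cab, Cac, Cad, Cbc, Cbd, Ccd}" for c by (cases c) auto
  then show ?thesis by auto
qed

text \<open>All parts are positive, so the weight bounds both their number and their sizes.\<close>

lemma finite_states: "finite {s. valid s \<and> weight (parts s) = n}"
proof -
  define P where "P = {1..n} \<times> (UNIV :: color set)"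
  define X where "X = {xs. set xs \<subseteq> P \<and> length xs \<le> n}"
  have "finite P" unfolding P_def UNIV_color by simp
  then have X: "finite X" unfolding X_def by (rule finite_lists_length_le)
  have "{s. valid s \<and> weight (parts s) = n} \<subseteq> X \<times> insert None (Some ` P) \<times> X"
  proof
    fix s assume "s \<in> {s. valid s \<and> weight (parts s) = n}"
    then have s: "valid s" "weight (parts s) = n" by auto
    obtain L y R where sf: "s = (L, y, R)" by (cases s)
    have len: "length (parts s) \<le> n" and elem: "\<And>x. x \<in> set (parts s) \<Longrightarrow> x \<in> P"
      using weight_bounds[OF valid_parts[OF s(1)]] valid_parts[OF s(1)] s(2) by (auto simp: P_def)
    show "s \<in> X \<times> insert None (Some ` P) \<times> X"
      using len elem unfolding sf X_def parts_def by (auto split: option.splits)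
  qed
  moreover have "finite (X \<times> insert None (Some ` P) \<times> X)"
    using X \<open>finite P\<close> by simp
  ultimately show ?thesis by (rule finite_subset)
qed

lemma count_A_eq_count_B: "count_A u v w t n = count_B u v w t n"
proof -
  define W where "W = {s. valid s \<and> has_content u v w t n (parts s)}"
  have fW: "finite W"
    unfolding W_def has_content_def by (rule finite_subset[OF _ finite_states[of n]]) auto
  have "bij_betw move (W - {s. finished s}) (W - {s. starting s})"
  proof (rule bij_betw_byWitness[where f' = unmove])
    show fwd: "move ` (W - {s. finished s}) \<subseteq> W - {s. starting s}"
      using unmove_move by (auto simp: W_def has_content_def)
    show "\<forall>s\<in>W - {s. finished s}. unmove (move s) = s"
      using unmove_move by (auto simp: W_def)
    show "\<forall>s\<in>W - {s. starting s}. move (unmove s) = s"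
      using move_unmove by (auto simp: W_def)
    show "unmove ` (W - {s. starting s}) \<subseteq> W - {s. finished s}"
    proof
      fix s' assume "s' \<in> unmove ` (W - {s. starting s})"
      then obtain s where s: "s' = unmove s" "valid s" "has_content u v w t n (parts s)" "\<not> starting s"
        by (auto simp: W_def)
      have b: "valid s'" "\<not> finished s'" "move s' = s" using move_unmove[OF s(2,4)] s(1) by auto
      \<comment> \<open>Content is known to be invariant under \<open>move\<close>; since
        \<open>move s' = s\<close>, it is invariant under \<open>unmove\<close>.\<close>
      then have "has_content u v w t n (parts s')"
        using unmove_move[OF b(1,2)] s(3) by (auto simp: has_content_def)
      then show "s' \<in> W - {s. finished s}" using b by (auto simp: W_def)
    qed
  qed
  then have "card (W - {s. finished s}) = card (W - {s. starting s})" by (rule bij_betw_same_card)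
  moreover have "card (W - {s. finished s}) = card W - card (W \<inter> {s. finished s})"
    "card (W - {s. starting s}) = card W - card (W \<inter> {s. starting s})"
    using fW by (simp_all add: card_Diff_subset_Int)
  moreover have "card (W \<inter> {s. finished s}) \<le> card W" "card (W \<inter> {s. starting s}) \<le> card W"
    using fW by (auto intro: card_mono)
  ultimately have "card (W \<inter> {s. starting s}) = card (W \<inter> {s. finished s})" by linarith
  moreover have "W \<inter> {s. starting s} = (\<lambda>R. ([], None, R)) ` {R. descending R \<and>
    has_content u v w t n R}"
    by (auto simp: W_def starting_def parts_def resting_def)
  \<comment> \<open>By \<open>coherent_Nil\<close> coherence is automatic for empty
    \<open>R\<close>, so every admissible word occurs.\<close>
  moreover have "W \<inter> {s. finished s} = (\<lambda>xs. (rev xs, None, [])) ` {xs. admissible xs \<and>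
    has_content u v w t n xs}"
  proof (intro equalityI subsetI)
    fix s :: state assume "s \<in> W \<inter> {s. finished s}"
    then obtain L where "s = (L, None, [])" "resting L []" "has_content u v w t n (rev L)"
      by (cases s) (auto simp: W_def finished_def parts_def)
    then show "s \<in> (\<lambda>xs. (rev xs, None, [])) ` {xs. admissible xs \<and> has_content u v w t n xs}"
      by (intro image_eqI[of _ _ "rev L"]) (auto simp: admissible_iff_rev_admissible resting_def)
  next
    fix s :: state assume "s \<in> (\<lambda>xs. (rev xs, None, [])) ` {xs. admissible xs \<and>
      has_content u v w t n xs}"
    then show "s \<in> W \<inter> {s. finished s}"
      using coherent_Nil[of "[]"] by (auto simp: W_def finished_def parts_def
        admissible_iff_rev_admissible resting_def)
  qed
  moreover have "card ((\<lambda>R. ([], None, R)) ` {R. descending R \<and>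
    has_content u v w t n R} :: state set) = count_A u v w t n"
    by (simp add: card_image inj_on_def count_A_eq)
  moreover have "card ((\<lambda>xs. (rev xs, None, [])) ` {xs. admissible xs \<and>
    has_content u v w t n xs} :: state set) = count_B u v w t n"
    by (simp add: card_image inj_on_def count_B_def has_content_def weight_def conj_ac)
  ultimately show ?thesis by simp
qed

section \<open>The generating function\<close>

unbundle no vec_syntax
unbundle fps_syntax


text \<open>The first \<open>N\<close> factors of the infinite product; factor \<open>k\<close> here
  is factor \<open>k - 1\<close> in \<open>qpochhammer_inf\<close>.\<close>

definition euler_prod :: "'r::comm_ring_1 \<Rightarrow> nat \<Rightarrow> 'r fps" where
  "euler_prod a N = (\<Prod>k\<in>{1..N}. 1 + fps_const a * fps_X ^ k)"

lemma euler_prod_Suc: "euler_prod a (Suc N) = euler_prod a N * (1 + fps_const a * fps_X ^ Suc N)"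
  unfolding euler_prod_def by (subst prod.nat_ivl_Suc') (auto simp: mult.commute)

text \<open>Each factor beyond the first \<open>m\<close> is 1 plus a multiple of a power of
  \<open>fps_X\<close> above \<open>m\<close>.\<close>

lemma euler_prod_nth: "m \<le> N \<Longrightarrow> euler_prod a N $ m = euler_prod a m $ m"
proof (induction rule: dec_induct)
  case (step N)
  have "euler_prod a (Suc N) = euler_prod a N + fps_const a * euler_prod a N * fps_X ^ Suc N"
    by (simp add: euler_prod_Suc algebra_simps)
  then have "euler_prod a (Suc N) $ m = euler_prod a N $ m"
    using step(1) by (simp only: fps_add_nth fps_X_power_mult_right_nth) simp
  then show ?case using step by simp
qed simp

lemma qpochhammer_inf_nth:
  fixes a :: "'r::comm_ring_1"
  assumes "m \<le> N"
  shows "qpochhammer_inf (- (fps_const a * fps_X)) fps_X $ m = euler_prod a N $ m"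
proof -
  define f where "f = (\<lambda>k. 1 - - (fps_const a * fps_X) * fps_X ^ k :: 'r fps)"
  define L where "L = Abs_fps (\<lambda>m. euler_prod a m $ m)"
  have prod_f: "(\<Prod>i\<le>n. f i) = euler_prod a (Suc n)" for n
  proof (induction n)
    case (Suc n)
    have "f (Suc n) = 1 + fps_const a * fps_X ^ Suc (Suc n)"
      by (simp add: f_def mult.assoc)
    then show ?case
      unfolding prod.atMost_Suc Suc.IH euler_prod_Suc[of a "Suc n"] by (rule arg_cong)
  qed (simp add: euler_prod_def f_def)
  have lim: "(\<lambda>n. \<Prod>i\<le>n. f i) \<longlonglongrightarrow> L"
  proof (rule tendsto_fpsI)
    fix m
    have "\<forall>n\<ge>m. (\<Prod>i\<le>n. f i) $ m = L $ m"
      unfolding prod_f L_def fps_nth_Abs_fps by (intro allI impI euler_prod_nth) simp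
    then show "\<forall>\<^sub>F n in sequentially. (\<Prod>i\<le>n. f i) $ m = L $ m"
      unfolding eventually_sequentially by blast
  qed
  \<comment> \<open>\<open>has_prod\<close> demands a nonzero limit.\<close>
  have "L $ 0 = 1" by (simp add: L_def euler_prod_def)
  then have "L \<noteq> 0" by auto
  \<comment> \<open>Excludes the clause of \<open>has_prod\<close> for products with a zero factor,
    so any value is the limit of the partial products.\<close>
  have f0: "f i \<noteq> 0" for i
  proof -
    have "f i $ 0 = 1" by (simp add: f_def)
    then show ?thesis by auto
  qed
  have "prodinf f = L"
    unfolding prodinf_def
  proof (rule the_equality)
    show "f has_prod L"
      using lim \<open>L \<noteq> 0\<close> by (simp add: has_prod_def raw_has_prod_def)
  next
    fix p assume "f has_prod p"
    then have "(\<lambda>n. \<Prod>i\<le>n. f i) \<longlonglongrightarrow> p"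
      using f0 by (simp add: has_prod_def raw_has_prod_def)
    then show "p = L" using lim by (rule LIMSEQ_unique)
  qed
  then have "qpochhammer_inf (- (fps_const a * fps_X)) fps_X = L"
    by (simp add: qpochhammer_inf_def f_def)
  then show ?thesis unfolding euler_prod_nth[OF assms] by (simp add: L_def)
qed

text \<open>\<open>S\<close> is the set of factors contributing
  \<open>fps_const a * fps_X ^ k\<close>, that is, a partition into distinct parts.\<close>

lemma euler_prod_expand:
  "euler_prod a N = (\<Sum>S\<in>Pow {1..N}. fps_const a ^ card S * fps_X ^ \<Sum>S)"
proof -
  have "euler_prod a N = (\<Sum>S\<in>Pow {1..N}. (\<Prod>k\<in>S. fps_const a * fps_X ^ k) * (\<Prod>k\<in>{1..N} - S. 1))"
    unfolding euler_prod_def by (subst add.commute, rule prod_add) simp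
  also have "\<dots> = (\<Sum>S\<in>Pow {1..N}. fps_const a ^ card S * fps_X ^ \<Sum>S)"
    by (simp add: prod.distrib power_sum)
  finally show ?thesis .
qed

lemma fps_mult_nth_cong:
  fixes f g :: "'r::comm_ring_1 fps"
  assumes "\<And>m. m \<le> n \<Longrightarrow> f $ m = f' $ m" "\<And>m. m \<le> n \<Longrightarrow> g $ m = g' $ m" "m \<le> n"
  shows "(f * g) $ m = (f' * g') $ m"
  unfolding fps_mult_nth using assms by (intro sum.cong) auto

section \<open>Coefficients and the sum over all contents\<close>

definition set_quadruples :: "nat \<Rightarrow> (nat set \<times> nat set \<times> nat set \<times> nat set) set" where
  "set_quadruples n = {(P, Q, R, S). P \<subseteq> {1..n} \<and> Q \<subseteq> {1..n} \<and> R \<subseteq> {1..n} \<and> S \<subseteq> {1..n} \<and>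
    \<Sum>P + \<Sum>Q + \<Sum>R + \<Sum>S = n}"

definition cards :: "nat set \<times> nat set \<times> nat set \<times> nat set \<Rightarrow> nat \<times> nat \<times> nat \<times> nat" where
  "cards = (\<lambda>(P, Q, R, S). (card P, card Q, card R, card S))"

lemma finite_set_quadruples: "finite (set_quadruples n)"
proof (rule finite_subset)
  show "set_quadruples n \<subseteq> Pow {1..n} \<times> Pow {1..n} \<times> Pow {1..n} \<times> Pow {1..n}"
    unfolding set_quadruples_def by auto
qed simp

lemma euler_prods_nth:
  fixes a b c d :: "'r::comm_ring_1"
  shows "(euler_prod a n * euler_prod b n * euler_prod c n * euler_prod d n) $ n =
    (\<Sum>(P, Q, R, S)\<in>set_quadruples n. a ^ card P * b ^ card Q * c ^ card R * d ^ card S)"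
proof -
  let ?K = "Pow {1..n}"
  let ?m = "\<lambda>(P, Q, R, S). fps_const (a ^ card P * b ^ card Q * c ^ card R * d ^ card S) *
      fps_X ^ (\<Sum>P + \<Sum>Q + \<Sum>R + \<Sum>S) :: 'r fps"
  have "euler_prod a n * euler_prod b n * euler_prod c n * euler_prod d n = 
      euler_prod a n * (euler_prod b n * (euler_prod c n * euler_prod d n))" by (simp add: mult.assoc)
  also have "\<dots> = sum ?m (?K \<times> ?K \<times> ?K \<times> ?K)"
    unfolding euler_prod_expand sum_product sum.cartesian_product
    by (intro sum.cong refl)
      (clarsimp simp only: fps_const_power [symmetric] power_add fps_const_mult [symmetric] mult_ac
        prod.case)
  finally have "(euler_prod a n * euler_prod b n * euler_prod c n * euler_prod d n) $ n =
      (\<Sum>z\<in>?K \<times> ?K \<times> ?K \<times> ?K. ?m z $ n)" by (simp add: fps_sum_nth)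
  also have "\<dots> = (\<Sum>z\<in>set_quadruples n. ?m z $ n)"
    by (rule sum.mono_neutral_right) (auto simp: set_quadruples_def split: if_splits)
  also have "\<dots> = (\<Sum>(P, Q, R, S)\<in>set_quadruples n. a ^ card P * b ^ card Q * c ^ card R * d ^ card S)"
    by (rule sum.cong) (auto simp: set_quadruples_def)
  finally show ?thesis .
qed

text \<open>No part exceeds the total \<open>n\<close>, so all quadruples live in the finite range
  \<open>{1..n}\<close>.\<close>

lemma count_A_eq_card: "count_A u v w t n = card {z \<in> set_quadruples n. cards z = (u, v, w, t)}"
proof -
  have le: "k \<le> \<Sum>P" if "finite P" "k \<in> P" for k :: nat and P
    using member_le_sum[of k P "\<lambda>k. k"] that by simp
  show ?thesis
    unfolding count_A_def
  proof (rule arg_cong[of _ _ card], intro equalityI subsetI)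
    fix z assume z: "z \<in> {(P, Q, R, S). P \<in> distinct_partitions u \<and> Q \<in> distinct_partitions v \<and>
                         R \<in> distinct_partitions w \<and> S \<in> distinct_partitions t \<and>
                         \<Sum>P + \<Sum>Q + \<Sum>R + \<Sum>S = n}"
    obtain P Q R S where e: "z = (P, Q, R, S)" by (rule prod_cases4)
    have sub: "X \<subseteq> {1..n}" if "X \<in> distinct_partitions i" "\<Sum>X \<le> n" for X i
    proof
      fix k assume k: "k \<in> X"
      then have "finite X" "1 \<le> k" using that(1) unfolding distinct_partitions_def by simp_all
      then show "k \<in> {1..n}" using le[of X k] k that(2) by simp
    qed
    have *: "P \<in> distinct_partitions u" "Q \<in> distinct_partitions v"
      "R \<in> distinct_partitions w" "S \<in> distinct_partitions t" "\<Sum>P + \<Sum>Q + \<Sum>R + \<Sum>S = n"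
      using z unfolding e by simp_all
    then have "P \<subseteq> {1..n}" "Q \<subseteq> {1..n}" "R \<subseteq> {1..n}" "S \<subseteq> {1..n}"
      using sub[of P u] sub[of Q v] sub[of R w] sub[of S t] by simp_all
    then show "z \<in> {z \<in> set_quadruples n. cards z = (u, v, w, t)}"
      using * unfolding e set_quadruples_def cards_def distinct_partitions_def by simp
  next
    fix z assume z: "z \<in> {z \<in> set_quadruples n. cards z = (u, v, w, t)}"
    obtain P Q R S where e: "z = (P, Q, R, S)" by (rule prod_cases4)
    have fin: "finite X \<and> (\<forall>k\<in>X. 1 \<le> k)" if "X \<subseteq> {1..n}" for X :: "nat set"
      using that finite_subset by fastforce
    show "z \<in> {(P, Q, R, S). P \<in> distinct_partitions u \<and> Q \<in> distinct_partitions v \<and>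
                         R \<in> distinct_partitions w \<and> S \<in> distinct_partitions t \<and>
                         \<Sum>P + \<Sum>Q + \<Sum>R + \<Sum>S = n}"
      using z fin[of P] fin[of Q] fin[of R] fin[of S]
        unfolding e set_quadruples_def cards_def distinct_partitions_def by simp
  qed
qed

lemma cards_le: "z \<in> set_quadruples n \<Longrightarrow> cards z \<in> {..n} \<times> {..n} \<times> {..n} \<times> {..n}"
proof -
  have "card X \<le> n" if "X \<subseteq> {1..n}" for X
    using card_mono[OF _ that] by simp
  then show "z \<in> set_quadruples n \<Longrightarrow> cards z \<in> {..n} \<times> {..n} \<times> {..n} \<times> {..n}"
    unfolding set_quadruples_def cards_def by auto
qed

text \<open>Truncating each product at \<open>n\<close> keeps the coefficient; the quadruples are
  then grouped by their four numbers of parts, each at most \<open>n\<close>.\<close>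

lemma gf_nth:
  fixes a b c d :: "'r::comm_ring_1"
  shows "(qpochhammer_inf (- (fps_const a * fps_X)) fps_X * qpochhammer_inf (- (fps_const
    b * fps_X)) fps_X *
      qpochhammer_inf (- (fps_const c * fps_X)) fps_X * qpochhammer_inf (- (fps_const d * fps_X))
        fps_X) $ n =
    (\<Sum>(u, v, w, t)\<in>{..n} \<times> {..n} \<times> {..n} \<times> {..n}. of_nat (count_A u v w t
      n) * a ^ u * b ^ v * c ^ w * d ^ t)"
proof -
  let ?g = "\<lambda>(u, v, w, t). a ^ u * b ^ v * c ^ w * d ^ t"
  let ?T = "{..n} \<times> {..n} \<times> {..n} \<times> {..n}"
  have "(qpochhammer_inf (- (fps_const a * fps_X)) fps_X * qpochhammer_inf (- (fps_const b * fps_X))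
    fps_X *
      qpochhammer_inf (- (fps_const c * fps_X)) fps_X * qpochhammer_inf (- (fps_const d * fps_X))
        fps_X) $ n =
      (euler_prod a n * euler_prod b n * euler_prod c n * euler_prod d n) $ n"
    by (intro fps_mult_nth_cong[of n] qpochhammer_inf_nth order.refl)
  also have "\<dots> = (\<Sum>z\<in>set_quadruples n. ?g (cards z))"
    unfolding euler_prods_nth by (intro sum.cong refl) (auto simp: cards_def)
  also have "\<dots> = (\<Sum>y\<in>?T. \<Sum>z\<in>{z \<in> set_quadruples n. cards z = y}. ?g (cards z))"
    using cards_le by (intro sum.group[symmetric] finite_set_quadruples image_subsetI) simp
  also have "\<dots> = (\<Sum>y\<in>?T. of_nat (card {z \<in> set_quadruples n. cards z = y}) * ?g y)"
    by (intro sum.cong refl) simp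
  also have "\<dots> = (\<Sum>(u, v, w, t)\<in>?T. of_nat (count_A u v w t n) * a ^ u * b ^ v * c ^ w * d ^ t)"
    by (intro sum.cong refl) (auto simp: count_A_eq_card mult.assoc)
  finally show ?thesis .
qed

text \<open>Convergence is coefficientwise: coefficient \<open>n\<close> is settled once the index
  set contains the box \<open>?e\<close> followed by \<open>?T\<close>. Terms with
  \<open>m \<noteq> n\<close> do not reach it, and outside the box the count vanishes.\<close>

lemma gf_has_sum:
  fixes a b c d :: "'r::comm_ring_1"
  shows "((\<lambda>(u, v, w, t, n). of_nat (count_A u v w t n) * fps_const a ^ u * fps_const b ^ v *
        fps_const c ^ w * fps_const d ^ t * fps_X ^ n)
      has_sum
        qpochhammer_inf (- (fps_const a * fps_X)) fps_X *
        qpochhammer_inf (- (fps_const b * fps_X)) fps_X *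
        qpochhammer_inf (- (fps_const c * fps_X)) fps_X *
        qpochhammer_inf (- (fps_const d * fps_X)) fps_X) UNIV"
    (is "(?f has_sum ?G) UNIV")
  unfolding has_sum_def
proof (rule tendsto_fpsI)
  fix n :: nat
  let ?T = "{..n} \<times> {..n} \<times> {..n} \<times> {..n}"
  let ?h = "\<lambda>(u, v, w, t). of_nat (count_A u v w t n) * a ^ u * b ^ v * c ^ w * d ^ t"
  let ?e = "\<lambda>(u, v, w, t). (u, v, w, t, n)"
  have coeff: "?f (u, v, w, t, m) $ n = (if m = n then ?h (u, v, w, t) else 0)" for u v w t m
    by (simp add: fps_of_nat[symmetric] fps_const_power del: fps_of_nat)
  have zero: "?h y = 0" if "y \<notin> ?T" for y
  proof -
    obtain u v w t where y: "y = (u, v, w, t)" by (rule prod_cases4)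
    have none: "{z \<in> set_quadruples n. cards z = (u, v, w, t)} = {}"
      using that cards_le[of _ n] unfolding y by fastforce
    have "count_A u v w t n = 0" unfolding count_A_eq_card none by simp
    then show ?thesis unfolding y by simp
  qed
  have sum_F: "sum ?f F $ n = ?G $ n" if F: "finite F" "?e ` ?T \<subseteq> F" for F
  proof -
    have "sum ?f F $ n = (\<Sum>z\<in>F. ?f z $ n)" by (rule fps_sum_nth)
    also have "\<dots> = (\<Sum>z\<in>?e ` ?T. ?f z $ n)"
    proof (rule sum.mono_neutral_right[OF F], rule ballI)
      fix z assume z: "z \<in> F - ?e ` ?T"
      obtain u v w t m where e: "z = (u, v, w, t, m)" by (rule prod_cases5)
      have "m \<noteq> n \<or> (u, v, w, t) \<notin> ?T" using z unfolding e by force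
      then show "?f z $ n = 0" unfolding e coeff using zero by auto
    qed
    also have "\<dots> = (\<Sum>y\<in>?T. ?f (?e y) $ n)"
      by (rule sum.reindex_cong[of ?e]) (auto simp: inj_on_def)
    also have "\<dots> = sum ?h ?T"
    proof (rule sum.cong[OF refl])
      fix y assume "y \<in> ?T"
      obtain u v w t where "y = (u, v, w, t)" by (rule prod_cases4)
      then show "?f (?e y) $ n = ?h y" using coeff by simp
    qed
    finally show ?thesis by (simp only: gf_nth)
  qed
  show "\<forall>\<^sub>F F in finite_subsets_at_top UNIV. sum ?f F $ n = ?G $ n"
    unfolding eventually_finite_subsets_at_top
    using sum_F by (intro exI[of _ "?e ` ?T"]) auto
qed

theorem theorem1p6:
  fixes a b c d :: "'r :: comm_ring_1"
  shows "(\<forall>u v w t n. count_A u v w t n = count_B u v w t n) \<and>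
    ((\<lambda>(u, v, w, t, n). of_nat (count_B u v w t n) * fps_const a ^ u * fps_const b ^ v *
        fps_const c ^ w * fps_const d ^ t * fps_X ^ n)
      has_sum
        qpochhammer_inf (- (fps_const a * fps_X)) fps_X *
        qpochhammer_inf (- (fps_const b * fps_X)) fps_X *
        qpochhammer_inf (- (fps_const c * fps_X)) fps_X *
        qpochhammer_inf (- (fps_const d * fps_X)) fps_X) UNIV"
  using gf_has_sum[of a b c d] unfolding count_A_eq_count_B by simp

end
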